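(* The center $\mathsf{Z}$ of $\mathsf{H}$ is generated as an algebra by $x_1^\ell,\ldots,x_n^\ell$ and $w$.
   Context: Fix integers $n\ge 3$ and $\ell\ge 2$, and let $\zeta$ be a primitive $\ell$-th root of unity. All subscripts are taken modulo $n$. Let $V=\mathbb{C}^n$ with standard basis $x_1,\ldots,x_n$, and let $G$ be the group of all diagonal matrices $g\in SL_n(\mathbb{C})$ with $g^\ell=1$, acting on $TV$. For $i=1,\ldots,n$ let $g_i\in G$ be given by $g_i(x_i)=\zeta x_i$, $g_i(x_{i+1})=\zeta^{-1}x_{i+1}$, $g_i(x_j)=x_j$ otherwise; $g_1,\ldots,g_{n-1}$ freely generate $G$ and $g_n=g_1^{-1}\cdots g_{n-1}^{-1}$. Define the 2-cocycle $\alpha$ by $\alpha(g_1^{i_1}\cdots g_{n-1}^{i_{n-1}},g_1^{j_1}\cdots g_{n-1}^{j_{n-1}})=\zeta^{-i_1j_2-\cdots-i_{n-2}j_{n-1}}$. For an algebra $E$ with $G$-action, $E\#_\alpha G$ is $E\otimes\mathbb{C}G$ with product $(r\otimes g)(s\otimes h)=\alpha(g,h)\,r\,(g\cdot s)\otimes gh$; for $g,h\in G$ write $g*h=\alpha(g,h)gh$. Let $t\in\mathbb{C}^n$. $\mathsf{H}$ is the quotient of $TV\#_\alpha G$ by the relations $x_ix_{i+1}-x_{i+1}x_i=t_ig_i$ for all $i$, and $x_ix_j=x_jx_i$ whenever $|i-j|\notin\{1,n-1\}$. For $p\in\mathbb{Z}_{\ge0}^n$, $x^p=x_1^{p_1}\cdots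 x_n^{p_n}$. Set $\tau_i=t_i/(\zeta-1)$ for $i<n$ and $\tau_n=\zeta t_n/(\zeta-1)$. Let $J$ be the set of subsets $\{i_1<\cdots<i_k\}\subseteq\{1,\ldots,n\}$ ($k\ge0$) with $|i_r-i_s|\notin\{1,n-1\}$ for all $r,s$. Let $\delta=(1,\ldots,1)\in\mathbb{Z}^n$ and $\varepsilon_i=e_i+e_{i+1}$ (so $\varepsilon_n=e_n+e_1$). Define $w=\sum_{\{i_1<\cdots<i_k\}\in J}\tau_{i_1}\cdots\tau_{i_k}\,x^{\delta-\varepsilon_{i_1}-\cdots-\varepsilon_{i_k}}\,g_{i_1}*\cdots*g_{i_k}\in\mathsf{H}$. *)

theory Defs
  imports Complex_Main
begin

text \<open>
Encoding.  A group element of G (a diagonal matrix diag(zeta^e_1,...,zeta^e_n) in SL_n with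
g^l = 1) is encoded by its exponent vector e :: nat => nat, with e j < l, e j = 0 outside
{1..n}, and (sum e_j) mod l = 0.  Elements of T V #_alpha G are finitely supported functions
from (word, group element) to complex numbers; the word [i1,...,ik] stands for x_i1 ... x_ik.
The algebra H is represented as (carrier Alg) modulo the two-sided ideal Ideal generated by
the defining relations; centre and generated subalgebra are described modulo Ideal.
\<close>

type_synonym grp = "nat \<Rightarrow> nat"
type_synonym elt = "nat list \<times> grp \<Rightarrow> complex"

definition Gset :: "nat \<Rightarrow> nat \<Rightarrow> grp set" where
  "Gset n l = {g. (\<forall>j. g j \<noteq> 0 \<longrightarrow> j \<in> {1..n}) \<and> (\<forall>j. g j < l)
                  \<and> (\<Sum>j=1..n. g j) mod l = 0}"

definition gmul :: "nat \<Rightarrow> nat \<Rightarrow> grp \<Rightarrow> grp \<Rightarrow> grp" where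
  "gmul n l g h = (\<lambda>j. if 1 \<le> j \<and> j \<le> n then (g j + h j) mod l else 0)"

definition gunit :: grp where "gunit = (\<lambda>_. 0)"

definition nxt :: "nat \<Rightarrow> nat \<Rightarrow> nat" where
  "nxt n i = (if i = n then 1 else i + 1)"

text \<open>g_i : x_i \<mapsto> zeta x_i, x_(i+1) \<mapsto> zeta^(-1) x_(i+1)\<close>
definition gen :: "nat \<Rightarrow> nat \<Rightarrow> nat \<Rightarrow> grp" where
  "gen n l i = (\<lambda>j. if j = i then 1 else if j = nxt n i then l - 1 else 0)"

text \<open>the cocycle: if g = g_1^i_1 ... g_(n-1)^i_(n-1) then i_k = e_1 + ... + e_k (mod l)\<close>
definition alpha :: "nat \<Rightarrow> complex \<Rightarrow> grp \<Rightarrow> grp \<Rightarrow> complex" where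
  "alpha n \<zeta> g h = inverse (\<zeta> ^ (\<Sum>k=1..n-2. (\<Sum>j=1..k. g j) * (\<Sum>j=1..k+1. h j)))"

text \<open>the action of g on the monomial word w is multiplication by chi g w\<close>
definition chi :: "complex \<Rightarrow> grp \<Rightarrow> nat list \<Rightarrow> complex" where
  "chi \<zeta> g w = \<zeta> ^ sum_list (map g w)"

definition supp :: "elt \<Rightarrow> (nat list \<times> grp) set" where
  "supp f = {x. f x \<noteq> 0}"

definition Alg :: "nat \<Rightarrow> nat \<Rightarrow> elt set" where
  "Alg n l = {f. finite (supp f) \<and>
      (\<forall>w g. f (w, g) \<noteq> 0 \<longrightarrow> set w \<subseteq> {1..n} \<and> g \<in> Gset n l)}"

definition add :: "elt \<Rightarrow> elt \<Rightarrow> elt" where "add f g = (\<lambda>x. f x + g x)"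
definition sub :: "elt \<Rightarrow> elt \<Rightarrow> elt" where "sub f g = (\<lambda>x. f x - g x)"
definition smul :: "complex \<Rightarrow> elt \<Rightarrow> elt" where "smul c f = (\<lambda>x. c * f x)"

text \<open>product of T V #_alpha G: (r # g)(s # h) = alpha(g,h) r (g.s) # gh\<close>
definition mult :: "nat \<Rightarrow> nat \<Rightarrow> complex \<Rightarrow> elt \<Rightarrow> elt \<Rightarrow> elt" where
  "mult n l \<zeta> f1 f2 = (\<lambda>(w, k).
     \<Sum>(p, q) \<in> {(p, q). p \<in> supp f1 \<and> q \<in> supp f2 \<and> fst p @ fst q = w
                          \<and> gmul n l (snd p) (snd q) = k}.
        f1 p * f2 q * alpha n \<zeta> (snd p) (snd q) * chi \<zeta> (snd p) (fst q))"

definition basis :: "nat list \<Rightarrow> grp \<Rightarrow> elt" where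
  "basis w g = (\<lambda>x. if x = (w, g) then 1 else 0)"

definition one :: elt where "one = basis [] gunit"
definition xv :: "nat \<Rightarrow> elt" where "xv i = basis [i] gunit"
definition gv :: "nat \<Rightarrow> nat \<Rightarrow> nat \<Rightarrow> elt" where "gv n l i = basis [] (gen n l i)"

fun mpow :: "nat \<Rightarrow> nat \<Rightarrow> complex \<Rightarrow> elt \<Rightarrow> nat \<Rightarrow> elt" where
  "mpow n l \<zeta> f 0 = one"
| "mpow n l \<zeta> f (Suc k) = mult n l \<zeta> f (mpow n l \<zeta> f k)"

definition Rels :: "nat \<Rightarrow> nat \<Rightarrow> complex \<Rightarrow> (nat \<Rightarrow> complex) \<Rightarrow> elt set" where
  "Rels n l \<zeta> t =
     {sub (sub (mult n l \<zeta> (xv i) (xv (nxt n i))) (mult n l \<zeta> (xv (nxt n i)) (xv i)))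
          (smul (t i) (gv n l i)) | i. i \<in> {1..n}}
   \<union> {sub (mult n l \<zeta> (xv i) (xv j)) (mult n l \<zeta> (xv j) (xv i)) | i j.
        i \<in> {1..n} \<and> j \<in> {1..n} \<and> \<bar>int i - int j\<bar> \<notin> {1, int n - 1}}"

inductive_set Ideal :: "nat \<Rightarrow> nat \<Rightarrow> complex \<Rightarrow> (nat \<Rightarrow> complex) \<Rightarrow> elt set"
  for n l \<zeta> t where
  rel: "r \<in> Rels n l \<zeta> t \<Longrightarrow> r \<in> Ideal n l \<zeta> t"
| zero: "(\<lambda>_. 0) \<in> Ideal n l \<zeta> t"
| add: "a \<in> Ideal n l \<zeta> t \<Longrightarrow> b \<in> Ideal n l \<zeta> t \<Longrightarrow> add a b \<in> Ideal n l \<zeta> t"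
| smul: "a \<in> Ideal n l \<zeta> t \<Longrightarrow> smul c a \<in> Ideal n l \<zeta> t"
| lmult: "a \<in> Ideal n l \<zeta> t \<Longrightarrow> c \<in> Alg n l \<Longrightarrow> mult n l \<zeta> c a \<in> Ideal n l \<zeta> t"
| rmult: "a \<in> Ideal n l \<zeta> t \<Longrightarrow> c \<in> Alg n l \<Longrightarrow> mult n l \<zeta> a c \<in> Ideal n l \<zeta> t"

inductive_set Gen :: "nat \<Rightarrow> nat \<Rightarrow> complex \<Rightarrow> elt set \<Rightarrow> elt set"
  for n l \<zeta> S where
  gen: "s \<in> S \<Longrightarrow> s \<in> Gen n l \<zeta> S"
| scalar: "smul c one \<in> Gen n l \<zeta> S"
| add: "a \<in> Gen n l \<zeta> S \<Longrightarrow> b \<in> Gen n l \<zeta> S \<Longrightarrow> add a b \<in> Gen n l \<zeta> S"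
| mult: "a \<in> Gen n l \<zeta> S \<Longrightarrow> b \<in> Gen n l \<zeta> S \<Longrightarrow> mult n l \<zeta> a b \<in> Gen n l \<zeta> S"

definition xpow :: "nat \<Rightarrow> nat \<Rightarrow> complex \<Rightarrow> (nat \<Rightarrow> nat) \<Rightarrow> elt" where
  "xpow n l \<zeta> p = foldr (\<lambda>j acc. mult n l \<zeta> (mpow n l \<zeta> (xv j) (p j)) acc) [1..<n+1] one"

definition gprod :: "nat \<Rightarrow> nat \<Rightarrow> complex \<Rightarrow> nat list \<Rightarrow> elt" where
  "gprod n l \<zeta> is = foldr (\<lambda>i acc. mult n l \<zeta> (gv n l i) acc) is one"

definition Jset :: "nat \<Rightarrow> nat set set" where
  "Jset n = {S. S \<subseteq> {1..n} \<and> (\<forall>r\<in>S. \<forall>s\<in>S. \<bar>int r - int s\<bar> \<notin> {1, int n - 1})}"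

definition tau :: "nat \<Rightarrow> complex \<Rightarrow> (nat \<Rightarrow> complex) \<Rightarrow> nat \<Rightarrow> complex" where
  "tau n \<zeta> t i = (if i < n then t i / (\<zeta> - 1) else \<zeta> * t n / (\<zeta> - 1))"

text \<open>exponent vector delta - eps_i1 - ... - eps_ik (entries are 0 or 1 for S in Jset n)\<close>
definition expo :: "nat \<Rightarrow> nat set \<Rightarrow> nat \<Rightarrow> nat" where
  "expo n S = (\<lambda>j. 1 - card {r \<in> S. j = r \<or> j = nxt n r})"

definition wel :: "nat \<Rightarrow> nat \<Rightarrow> complex \<Rightarrow> (nat \<Rightarrow> complex) \<Rightarrow> elt" where
  "wel n l \<zeta> t = (\<lambda>x. \<Sum>S\<in>Jset n. (\<Prod>i\<in>S. tau n \<zeta> t i) *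
       mult n l \<zeta> (xpow n l \<zeta> (expo n S)) (gprod n l \<zeta> (sorted_list_of_set S)) x)"

text \<open>preimage in T V #_alpha G of the centre Z of H\<close>
definition Center :: "nat \<Rightarrow> nat \<Rightarrow> complex \<Rightarrow> (nat \<Rightarrow> complex) \<Rightarrow> elt set" where
  "Center n l \<zeta> t = {z \<in> Alg n l. \<forall>a \<in> Alg n l.
      sub (mult n l \<zeta> z a) (mult n l \<zeta> a z) \<in> Ideal n l \<zeta> t}"

text \<open>preimage of the subalgebra of H generated by x_1^l, ..., x_n^l and w\<close>
definition GenZ :: "nat \<Rightarrow> nat \<Rightarrow> complex \<Rightarrow> (nat \<Rightarrow> complex) \<Rightarrow> elt set" where
  "GenZ n l \<zeta> t = {z \<in> Alg n l. \<exists>y \<in> Gen n l \<zeta>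
       (insert (wel n l \<zeta> t) {mpow n l \<zeta> (xv i) l | i. i \<in> {1..n}}).
       sub z y \<in> Ideal n l \<zeta> t}"

end

(*
H embeds into the localised algebra C[y_1^{+-1},...,y_n^{+-1}] #_alpha G, a twisted group algebra of an
abelian group, by x_j |-> u_j + v_j with u_j = y_j and v_{j+1} = - t_j / (zeta - 1) y_j^{-1} g_j
(indices mod n).  The u_j commute, the v_j commute, and u_j v_{j+1} is a multiple of g_j.  Comparing
top-degree terms under this map shows that the monomials x^p g are linearly independent in H.

Since u_j v_{j+1} = - tau_j g_j, the sum defining w is the inclusion-exclusion expansion of the sum of
those words in the u_j and v_j that contain no cyclic factor u_j v_{j+1}.  Only two words survive, so
w = u_1...u_n + v_1...v_n, and this is visibly central.  The powers x_i^l are central because the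
q-number [l] vanishes at q = zeta.

Conversely, the top-degree part of a central element commutes with every x_j and every g in
C[x_1,...,x_n] #_alpha G, hence lies in the span of the x^p with p_1 = ... = p_n mod l.  These x^p
are the leading terms of the products of w and the x_i^l, so induction on the degree concludes.
*)
theory Submission
  imports "HOL-Number_Theory.Cong" "HOL-Library.Multiset" Defs
begin

section \<open>The ring of linear operators on complex functions\<close>

text \<open>The localised algebra is not built as an algebra. Its elements are represented by the
  transposes of right multiplications, acting on functions on the monomials y^a h; since both steps
  reverse the order of factors, products keep their order. The ring laws come from composition of
  operators, so no associativity law for \<open>mult\<close> has to be checked. The kernel of
  \<open>\<phi>\<close> on \<open>Alg n l\<close> turns out to be exactly the ideal
  (\<open>Ideal_iff\<close>), which turns both sides of the theorem into statements about operators.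

  The shape of v_(j+1) is forced. If the u commute and the v commute, the commutator of x_j and
  x_(j+1) reduces to u_j v_(j+1) - v_(j+1) u_j = (1 - zeta) u_j v_(j+1), and this has to be t_j g_j.
  The cocycle enters through the commutator of h and g_j, which is zeta^(h_j + h_(j+1)): it gives
  y_j^(-1) g_j the weight of x_(j+1) under G, and it makes the v commute.\<close>

typedef 'a lop =
  "{T :: ('a \<Rightarrow> complex) \<Rightarrow> 'a \<Rightarrow> complex. \<forall>F G c m. T (\<lambda>x. F x + c * G x) m = T F m + c * T G m}"
  morphisms app Lop
  by (rule exI[of _ "\<lambda>F m. 0"]) simp

setup_lifting type_definition_lop

instantiation lop :: (type) ring_1
begin
lift_definition zero_lop :: "'a lop" is "\<lambda>F m. 0" by simp
lift_definition one_lop :: "'a lop" is "\<lambda>F. F" by simp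
lift_definition plus_lop :: "'a lop \<Rightarrow> 'a lop \<Rightarrow> 'a lop" is "\<lambda>S T F m. S F m + T F m"
  by (simp add: algebra_simps)
lift_definition minus_lop :: "'a lop \<Rightarrow> 'a lop \<Rightarrow> 'a lop" is "\<lambda>S T F m. S F m - T F m"
  by (simp add: algebra_simps)
lift_definition uminus_lop :: "'a lop \<Rightarrow> 'a lop" is "\<lambda>T F m. - T F m"
  by (simp add: algebra_simps)
lift_definition times_lop :: "'a lop \<Rightarrow> 'a lop \<Rightarrow> 'a lop" is "\<lambda>S T F. S (T F)"
proof goal_cases
  case (1 S T)
  then have "T (\<lambda>x. F x + c * G x) = (\<lambda>m. T F m + c * T G m)" for F G c
    by auto
  with 1 show ?case by simp
qed
instance
proof
  fix a b c :: "'a lop"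
  show "a * b * c = a * (b * c)" by transfer simp
  show "1 * a = a" "a * 1 = a" by (transfer, simp)+
  show "a + b + c = a + (b + c)" "a + b = b + a" "0 + a = a" "- a + a = 0" "a - b = a + - b"
    by (transfer, simp add: fun_eq_iff)+
  show "(a + b) * c = a * c + b * c" by transfer simp
  show "a * (b + c) = a * b + a * c"
  proof (transfer, intro ext)
    fix a b c :: "('a \<Rightarrow> complex) \<Rightarrow> 'a \<Rightarrow> complex" and F m
    assume "\<forall>F G k m. a (\<lambda>x. F x + k * G x) m = a F m + k * a G m"
    from spec[OF spec[OF spec[OF spec[OF this, of "b F"], of "c F"], of 1], of m]
    show "a (\<lambda>m. b F m + c F m) m = a (b F) m + a (c F) m" by simp
  qed
  show "(0::'a lop) \<noteq> 1"
    by transfer (metis zero_neq_one)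
qed
end

lift_definition sc :: "complex \<Rightarrow> 'a lop \<Rightarrow> 'a lop" (infixr "\<star>" 75) is "\<lambda>c T F m. c * T F m"
  by (simp add: algebra_simps)

lemma app_zero [simp]: "app 0 F m = 0"
  and app_one [simp]: "app 1 F = F"
  and app_plus [simp]: "app (S + T) F m = app S F m + app T F m"
  and app_times [simp]: "app (S * T) F = app S (app T F)"
  and app_sc [simp]: "app (c \<star> T) F m = c * app T F m"
  by (transfer, simp)+

lemma app_sum: "app (sum f A) F m = (\<Sum>x\<in>A. app (f x) F m)"
  by (induction A rule: infinite_finite_induct) auto

lemma lop_eqI: "(\<And>F m. app S F m = app T F m) \<Longrightarrow> S = T"
  by (metis app_inject ext)

lemma app_lin: "app T (\<lambda>x. c * F x) m = c * app T F m"
  \<comment> \<open>The second instance, with both functions zero and c = 1, gives T 0 = 0; the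
    first then yields homogeneity.\<close>
  using app[of T, simplified, THEN spec, of "\<lambda>x. 0", THEN spec, of F, THEN spec, of c, THEN spec, of m]
    app[of T, simplified, THEN spec, of "\<lambda>x. 0", THEN spec, of "\<lambda>x. 0", THEN spec, of 1, THEN spec, of m]
  by simp

lemma sc_times_left [simp]: "(c \<star> S) * T = c \<star> (S * T)"
  by transfer simp

lemma sc_times_right [simp]: "S * (c \<star> T) = c \<star> (S * T)"
  by (rule lop_eqI) (simp, metis app_lin app_sc ext)

lemma sc_sc [simp]: "c \<star> d \<star> T = (c * d) \<star> T"
  by transfer (simp add: mult.assoc)

lemma sc_one [simp]: "1 \<star> T = T"
  and sc_zero [simp]: "0 \<star> T = 0"
  and sc_zero_right [simp]: "c \<star> 0 = 0"
  by (transfer, simp)+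

lemma sc_add_right: "c \<star> (S + T) = c \<star> S + c \<star> T"
  and sc_diff_right: "c \<star> (S - T) = c \<star> S - c \<star> T"
  and sc_add_left: "(c + d) \<star> T = c \<star> T + d \<star> T"
  and sc_diff_left: "(c - d) \<star> T = c \<star> T - d \<star> T"
  and sc_minus_left: "(- c) \<star> T = - (c \<star> T)"
  and sc_minus_right: "c \<star> (- T) = - (c \<star> T)"
  by (transfer, simp add: algebra_simps)+

lemmas sc_simps = sc_add_right sc_diff_right sc_add_left sc_diff_left sc_minus_left sc_minus_right

lemma sc_sum: "c \<star> sum f A = (\<Sum>x\<in>A. c \<star> f x)"
  by (induction A rule: infinite_finite_induct) (auto simp: sc_add_right)

lemma sum_sc: "sum f A \<star> T = (\<Sum>x\<in>A. f x \<star> T)"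
  by (induction A rule: infinite_finite_induct) (auto simp: sc_add_left)

section \<open>Commutation up to scalars\<close>

lemma commute_mult:
  fixes T :: "'a::semigroup_mult"
  assumes "T * A = A * T" "T * B = B * T"
  shows "T * (A * B) = A * B * T"
proof -
  have "T * (A * B) = A * (T * B)" by (simp add: assms(1) flip: mult.assoc)
  then show ?thesis by (simp add: assms(2) mult.assoc)
qed

lemma prod_list_qcommute:
  fixes T :: "'a lop"
  assumes "\<And>j. j \<in> set js \<Longrightarrow> T * f j = c j \<star> (f j * T)"
  shows "T * prod_list (map f js) = prod_list (map c js) \<star> (prod_list (map f js) * T)"
  using assms
proof (induction js)
  case (Cons j js)
  have "T * (f j * prod_list (map f js)) = c j \<star> (f j * (T * prod_list (map f js)))"
    using Cons.prems by (simp flip: mult.assoc)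
  with Cons show ?case by (simp add: mult.assoc)
qed simp

text \<open>Moving \<open>A\<close> across one factor \<open>B\<close> leaves one \<open>H\<close>,
  and moving that \<open>H\<close> across the m factors \<open>B\<close> to its right costs q^m; the
  sum is the q-number [k]. At k = 0 the truncated exponent \<open>k - 1\<close> is harmless because
  the sum is empty.\<close>

lemma q_power_commute:
  fixes A :: "'a lop"
  assumes AB: "A * B = B * A + c \<star> H" and HB: "H * B = q \<star> (B * H)"
  shows "A * B ^ k = B ^ k * A + (c * (\<Sum>m<k. q ^ m)) \<star> (B ^ (k - 1) * H)"
proof (induction k)
  case (Suc k)
  have H: "H * B ^ k = q ^ k \<star> (B ^ k * H)" for k
  proof (induction k)
    case (Suc k)
    have "H * (B * B ^ k) = q \<star> (B * (H * B ^ k))" using HB by (simp flip: mult.assoc)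
    with Suc show ?case by (simp add: mult.assoc)
  qed simp
  have "A * B ^ Suc k = B * (A * B ^ k) + c \<star> (H * B ^ k)"
    by (simp add: AB distrib_right flip: mult.assoc)
  also have "B * (A * B ^ k) = B ^ Suc k * A + (c * (\<Sum>m<k. q ^ m)) \<star> (B ^ k * H)"
    unfolding Suc by (cases k) (simp_all add: distrib_left mult.assoc)
  finally show ?case by (simp add: H distrib_left sc_add_left add.assoc)
qed simp

type_synonym pt = "(nat \<Rightarrow> int) \<times> grp"

section \<open>The group and its cocycle\<close>

locale twisted_hecke =
  fixes n l :: nat and \<zeta> :: complex and t :: "nat \<Rightarrow> complex"
  assumes n3: "n \<ge> 3" and l2: "l \<ge> 2" and root: "\<zeta> ^ l = 1"
    and prim: "\<And>k. 0 < k \<Longrightarrow> k < l \<Longrightarrow> \<zeta> ^ k \<noteq> 1"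
begin

lemma zeta_neq_0 [simp]: "\<zeta> \<noteq> 0"
  using root l2 by (metis not_numeral_le_zero power_0_left zero_neq_one)

lemma zeta_neq_1: "\<zeta> \<noteq> 1"
  using prim[of 1] l2 by auto

lemma zpow_mod: "\<zeta> ^ (k mod l) = \<zeta> ^ k"
proof -
  have "\<zeta> ^ k = \<zeta> ^ (l * (k div l) + k mod l)" by simp
  also have "\<dots> = \<zeta> ^ (k mod l)" unfolding power_add power_mult root by simp
  finally show ?thesis by simp
qed

lemma zpow_cong: "[a = b] (mod l) \<Longrightarrow> \<zeta> ^ a = \<zeta> ^ b"
  by (metis cong_def zpow_mod)

lemma zpow_eq_1: "\<zeta> ^ a = 1 \<longleftrightarrow> l dvd a"
  using prim[of "a mod l"] l2 zpow_mod[of a] by (auto simp: dvd_eq_mod_eq_0)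

lemma zpow_pred: "\<zeta> ^ (l - 1) = inverse \<zeta>"
proof -
  have "\<zeta> * \<zeta> ^ (l - 1) = 1" using root l2 by (simp flip: power_Suc)
  then show ?thesis by (metis inverse_unique)
qed

abbreviation "psum g k \<equiv> (\<Sum>j=1..k. (g::grp) j)"

abbreviation tw :: "elt \<Rightarrow> elt \<Rightarrow> elt" (infixl "\<odot>" 70) where "a \<odot> b \<equiv> mult n l \<zeta> a b"
abbreviation al where "al \<equiv> alpha n \<zeta>"
abbreviation gm where "gm \<equiv> gmul n l"
abbreviation ge where "ge \<equiv> gen n l"
abbreviation nx where "nx \<equiv> nxt n"

definition pr :: "nat \<Rightarrow> nat" where "pr j = (if j = 1 then n else j - 1)"

lemma nx_pr: "j \<in> {1..n} \<Longrightarrow> nx (pr j) = j" and pr_in: "j \<in> {1..n} \<Longrightarrow> pr j \<in> {1..n}"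
  and pr_nx: "j \<in> {1..n} \<Longrightarrow> pr (nx j) = j" and nx_in: "j \<in> {1..n} \<Longrightarrow> nx j \<in> {1..n}"
  and nx_neq: "nx j \<noteq> j"
  using n3 by (auto simp: pr_def nxt_def)

lemma psum_gm: "k \<le> n \<Longrightarrow> [psum (gm g h) k = psum g k + psum h k] (mod l)"
  unfolding sum.distrib[symmetric]
  by (rule cong_sum) (auto simp: gmul_def cong_def)

text \<open>The exponent of the cocycle is bilinear in the partial sums modulo l, so
  \<open>alpha\<close> is a bicharacter. With \<open>al_hact\<close> for the first argument this is
  the cocycle identity behind \<open>G_G\<close>.\<close>

lemma al_gm_right: "al g (gm h h') = al g h * al g h'"
proof -
  have "[(\<Sum>k=1..n-2. psum g k * psum (gm h h') (k+1))
       = (\<Sum>k=1..n-2. psum g k * (psum h (k+1) + psum h' (k+1)))] (mod l)"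
    by (intro cong_sum cong_mult psum_gm) auto
  from zpow_cong[OF this] show ?thesis
    by (simp add: alpha_def distrib_left sum.distrib power_add)
qed

lemma al_unit [simp]: "al gunit h = 1" "al h gunit = 1"
  by (simp_all add: alpha_def gunit_def)

lemma gm_comm: "gm g h = gm h g"
  by (auto simp: gmul_def fun_eq_iff ac_simps mod_simps)

lemma Gset_gunit [simp]: "gunit \<in> Gset n l"
  using l2 by (auto simp: Gset_def gunit_def)

lemma gm_gunit [simp]: "g \<in> Gset n l \<Longrightarrow> gm gunit g = g" "g \<in> Gset n l \<Longrightarrow> gm g gunit = g"
  by (force simp: gmul_def fun_eq_iff gunit_def Gset_def)+

lemma Gset_gm [simp]: "g \<in> Gset n l \<Longrightarrow> h \<in> Gset n l \<Longrightarrow> gm g h \<in> Gset n l"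
proof -
  assume gh: "g \<in> Gset n l" "h \<in> Gset n l"
  then have "[psum (gm g h) n = 0 + 0] (mod l)"
    by (intro cong_trans[OF psum_gm] cong_add) (auto simp: Gset_def cong_def)
  with l2 show ?thesis by (auto simp: Gset_def gmul_def cong_def)
qed

lemma ge_val: "ge k k = 1" "ge k (nx k) = l - 1" "j \<noteq> k \<Longrightarrow> j \<noteq> nx k \<Longrightarrow> ge k j = 0"
  using nx_neq[of k] by (auto simp: gen_def)

text \<open>For m < n these are, modulo l, the coordinates of \<open>ge k\<close> in terms of g_1,
  ..., g_(n-1): a unit vector for k < n, and -1 in every place for k = n. The values are left
  unreduced.\<close>

lemma psum_ge: "k \<in> {1..n} \<Longrightarrow> psum (ge k) m =
   (if k < n then (if m < k then 0 else if m = k then 1 else l)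
    else (if m = 0 then 0 else if m < n then l - 1 else l))"
proof (induction m)
  case (Suc m)
  then show ?case using l2 n3 by (auto simp: gen_def nxt_def)
qed auto

lemma Gset_ge [simp]: "k \<in> {1..n} \<Longrightarrow> ge k \<in> Gset n l"
proof -
  assume k: "k \<in> {1..n}"
  then show ?thesis using l2 n3 psum_ge[OF k, of n] by (auto simp: Gset_def gen_def nxt_def)
qed

text \<open>This is the commutator pairing of the twisted group algebra. The case k = n needs its
  own computation because g_n is not one of the free generators.\<close>

lemma al_ge_comm:
  assumes h: "h \<in> Gset n l" and k: "k \<in> {1..n}"
  shows "al h (ge k) = \<zeta> ^ (h k + h (nx k)) * al (ge k) h"
proof -
  let ?E1 = "\<Sum>m=1..n-2. psum (ge k) m * psum h (m+1)"
  let ?E2 = "\<Sum>m=1..n-2. psum h m * psum (ge k) (m+1)"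
  have hn: "[psum h n = 0] (mod l)" using h by (simp add: Gset_def cong_def)
  have "[?E1 = h k + h (nx k) + ?E2] (mod l)"
  proof (cases "k < n")
    case True
    have "[?E1 = (\<Sum>m=1..n-2. if m = k then psum h (k+1) else 0)] (mod l)"
      using True k by (intro cong_sum) (auto simp: psum_ge cong_def simp del: One_nat_def sum.cl_ivl_Suc)
    also have "(\<Sum>m=1..n-2. if m = k then psum h (k+1) else 0)
        = (if k \<le> n - 2 then psum h (k+1) else 0)"
      using k by (simp add: sum.delta')
    \<comment> \<open>For k = n - 1 the sum lacks the term m = k, but then \<open>psum h n\<close>
      vanishes modulo l because h has determinant 1.\<close>
    also have "[\<dots> = psum h (k+1)] (mod l)"
    proof (cases "k \<le> n - 2")
      case False
      then have "k + 1 = n" using True by simp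
      then show ?thesis using hn False by (simp add: cong_sym_eq)
    qed simp
    finally have 1: "[?E1 = psum h (k+1)] (mod l)" .
    have "[?E2 = (\<Sum>m=1..n-2. if m = k - 1 then psum h (k-1) else 0)] (mod l)"
      using True k by (intro cong_sum) (auto simp: psum_ge cong_def simp del: One_nat_def sum.cl_ivl_Suc)
    also have "(\<Sum>m=1..n-2. if m = k - 1 then psum h (k-1) else 0) = psum h (k-1)"
      using k True by (cases "k = 1") (auto simp: sum.delta')
    finally have 2: "[?E2 = psum h (k-1)] (mod l)" .
    have "psum h (k+1) = h k + h (nx k) + psum h (k-1)"
      using k True by (cases k) (auto simp: nxt_def)
    then have "[psum h (k+1) = h k + h (nx k) + ?E2] (mod l)"
      using cong_sym[OF cong_add[OF cong_refl 2]] by (simp only:)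
    then show ?thesis by (rule cong_trans[OF 1])
  next
    case False
    then have kn: "k = n" using k by simp
    \<comment> \<open>Every partial sum of \<open>ge n\<close> that occurs is l - 1, that is -1
      modulo l; the two remaining sums differ by a telescoping shift.\<close>
    let ?S = "\<Sum>m=1..n-2. psum h m" and ?T = "\<Sum>m=1..n-2. psum h (m+1)"
    have E1: "?E1 = (l-1) * ?T"
      unfolding sum_distrib_left[of "l-1" "\<lambda>m. psum h (m+1)"]
      by (rule sum.cong) (use k kn n3 in \<open>auto simp: psum_ge simp del: One_nat_def sum.cl_ivl_Suc\<close>)
    have E2: "?E2 = (l-1) * ?S"
      unfolding sum_distrib_left[of "l-1" "\<lambda>m. psum h m"]
      by (rule sum.cong) (use k kn n3 in \<open>auto simp: psum_ge simp del: One_nat_def sum.cl_ivl_Suc\<close>)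
    have ST: "?T + h 1 = ?S + psum h (n-1)"
    proof -
      have "(\<Sum>m=1..q. psum h (m+1)) + h 1 = (\<Sum>m=1..q. psum h m) + psum h (q+1)" for q
        by (induction q) auto
      from this[of "n-2"] n3 show ?thesis by (simp add: numeral_2_eq_2 Suc_diff_Suc)
    qed
    have nn: "psum h n = psum h (n-1) + h n" using n3 by (cases n) auto
    \<comment> \<open>The congruence is checked over the integers, where L - 1 acts as -1 modulo L
      and differences do not truncate.\<close>
    have dvd_aux: "L dvd (L - 1) * T - (b + a + (L - 1) * S)"
      if "T + a = S + p" "p + b = L * q" for L T S a b p q :: int
    proof -
      have T: "T = S + p - a" using that(1) by simp
      have "(L - 1) * T - (b + a + (L - 1) * S) = L * (p - a) - (p + b)"
        unfolding T by (simp add: algebra_simps)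
      also have "\<dots> = L * (p - a - q)" unfolding that(2) by (simp add: algebra_simps)
      finally have "(L - 1) * T - (b + a + (L - 1) * S) = L * (p - a - q)" .
      then show ?thesis by simp
    qed
    have "l dvd psum h (n-1) + h n" using hn nn by (simp only: cong_0_iff)
    then obtain q where "psum h (n-1) + h n = l * q" by (auto elim: dvdE)
    then have "int (psum h (n-1)) + int (h n) = int l * int q" by (simp only: flip: of_nat_add of_nat_mult)
    moreover have "int ?T + int (h 1) = int ?S + int (psum h (n-1))"
      using ST by (simp only: flip: of_nat_add)
    ultimately have "int l dvd (int l - 1) * int ?T - (int (h n) + int (h 1) + (int l - 1) * int ?S)"
      by (intro dvd_aux)
    moreover have "int l - 1 = int (l - 1)" using l2 by simp
    ultimately have "int l dvd int ?E1 - int (h n + h 1 + ?E2)"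
      unfolding E1 E2 by (simp only: of_nat_add of_nat_mult)
    then have "[?E1 = h n + h 1 + ?E2] (mod l)"
      by (simp only: cong_iff_dvd_diff flip: cong_int_iff)
    then show ?thesis using kn by (simp only: nxt_def simp_thms if_True)
  qed
  from zpow_cong[OF this] have E: "\<zeta> ^ ?E1 = \<zeta> ^ (h k + h (nx k)) * \<zeta> ^ ?E2"
    by (simp only: power_add)
  have "a = b * c \<Longrightarrow> b \<noteq> 0 \<Longrightarrow> inverse c = b * inverse a" for a b c :: complex
    by (auto simp: field_simps)
  from this[OF E] show ?thesis unfolding alpha_def by (simp only: power_not_zero zeta_neq_0 not_False_eq_True)
qed

section \<open>The operators of the localised algebra\<close>

text \<open>The exponents of \<open>h\<close> are changed modulo \<open>l\<close> while their quotients by \<open>l\<close> are kept, so that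
  \<open>gunit\<close> acts as the identity on every function and not only on reduced exponent vectors.\<close>

definition hact :: "grp \<Rightarrow> grp \<Rightarrow> grp" where
  "hact h g = (\<lambda>j. if 1 \<le> j \<and> j \<le> n then l * (h j div l) + (h j + g j) mod l else h j)"

lemma hact_mod: "j \<in> {1..n} \<Longrightarrow> [hact h g j = h j + g j] (mod l)"
  by (simp add: hact_def cong_def)

lemma hact_gm: "hact (hact h g) g' = hact h (gm g g')"
proof
  fix j
  have "(l * q + r mod l) div l = q" for q r
    using l2 by simp
  then show "hact (hact h g) g' j = hact h (gm g g') j"
    using l2 by (auto simp: hact_def gmul_def mod_simps add.assoc)
qed

lemma hact_gunit [simp]: "hact h gunit = h"
  by (auto simp: hact_def gunit_def fun_eq_iff)

lemma hact_unit [simp]: "g \<in> Gset n l \<Longrightarrow> hact gunit g = g"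
  by (force simp: hact_def gunit_def fun_eq_iff Gset_def)

lemma al_hact: "al (hact h g) g' = al h g' * al g g'"
proof -
  have "[(\<Sum>k=1..n-2. psum (hact h g) k * psum g' (k+1))
       = (\<Sum>k=1..n-2. (psum h k + psum g k) * psum g' (k+1))] (mod l)"
    unfolding sum.distrib[symmetric] by (intro cong_sum cong_mult hact_mod) auto
  from zpow_cong[OF this] show ?thesis
    by (simp add: alpha_def distrib_right sum.distrib power_add)
qed

text \<open>A function on \<open>pt\<close> is a linear functional on the span of the monomials \<open>y^a h\<close>, and the operators
  \<open>Y j\<close>, \<open>Yi j\<close> and \<open>G g\<close> are dual to right multiplication by \<open>y_j\<close>, \<open>y_j^(-1)\<close> and \<open>g\<close>.\<close>

lift_definition Y :: "nat \<Rightarrow> pt lop" is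
  "\<lambda>j F (a, h). \<zeta> ^ h j * F (a(j := a j + 1), h)"
  by (auto simp: algebra_simps)

lift_definition Yi :: "nat \<Rightarrow> pt lop" is
  "\<lambda>j F (a, h). inverse (\<zeta> ^ h j) * F (a(j := a j - 1), h)"
  by (auto simp: algebra_simps)

lift_definition G :: "grp \<Rightarrow> pt lop" is
  "\<lambda>g F (a, h). al h g * F (a, hact h g)"
  by (auto simp: algebra_simps)

lemma app_Y [simp]: "app (Y j) F (a, h) = \<zeta> ^ h j * F (a(j := a j + 1), h)"
  and app_Yi [simp]: "app (Yi j) F (a, h) = inverse (\<zeta> ^ h j) * F (a(j := a j - 1), h)"
  and app_G [simp]: "app (G g) F (a, h) = al h g * F (a, hact h g)"
  by (transfer, simp)+

lemma lop_pt_eqI: "(\<And>F a h. app S F (a, h) = app T F (a, h)) \<Longrightarrow> S = (T :: pt lop)"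
  by (rule lop_eqI) auto

lemma Y_Y: "Y i * Y j = Y j * Y i" and Yi_Yi: "Yi i * Yi j = Yi j * Yi i"
  and Y_inv: "Y j * Yi j = 1"
  by (rule lop_pt_eqI; cases "i = j"; simp add: fun_upd_twist)+

lemma Yi_Y: "Yi i * Y j = Y j * Yi i"
  by (rule lop_pt_eqI; cases "i = j"; simp add: fun_upd_twist)

lemma G_one [simp]: "G gunit = 1"
  by (rule lop_pt_eqI) simp

lemma G_G: "G g * G h = al g h \<star> G (gm g h)"
  by (rule lop_pt_eqI) (simp add: hact_gm al_hact al_gm_right)

lemma G_Y: "j \<in> {1..n} \<Longrightarrow> G g * Y j = \<zeta> ^ g j \<star> (Y j * G g)"
  by (rule lop_pt_eqI) (simp add: zpow_cong[OF hact_mod] power_add)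

lemma G_Yi: "j \<in> {1..n} \<Longrightarrow> G g * Yi j = inverse (\<zeta> ^ g j) \<star> (Yi j * G g)"
  by (rule lop_pt_eqI) (simp add: zpow_cong[OF hact_mod] power_add)

lemma G_ge: "h \<in> Gset n l \<Longrightarrow> k \<in> {1..n} \<Longrightarrow> G h * G (ge k) = \<zeta> ^ (h k + h (nx k)) \<star> (G (ge k) * G h)"
  by (simp add: G_G al_ge_comm gm_comm)

text \<open>\<open>W k\<close> is the element \<open>v_(k+1)\<close> of the introduction (cyclic index).\<close>

definition W :: "nat \<Rightarrow> pt lop" where
  "W k = (- t k / (\<zeta> - 1)) \<star> (Yi k * G (ge k))"

definition X :: "nat \<Rightarrow> pt lop" where "X j = Y j + W (pr j)"

lemma W_Y: "i \<in> {1..n} \<Longrightarrow> W k * Y i = \<zeta> ^ ge k i \<star> (Y i * W k)"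
  unfolding W_def by (simp add: mult.assoc G_Y) (simp add: Yi_Y mult_ac flip: mult.assoc)

lemma Y_W: "Y k * W k = (- t k / (\<zeta> - 1)) \<star> G (ge k)"
  by (simp add: W_def Y_inv flip: mult.assoc)

text \<open>The exponents -h_k from \<open>Yi k\<close> and h_k + h_(k+1) from \<open>G_ge\<close>
  add up to h_(k+1), so v_(k+1) has the same weight under G as u_(k+1), and \<open>X\<close> is
  homogeneous in \<open>G_X\<close>.\<close>

lemma G_W:
  assumes "h \<in> Gset n l" "k \<in> {1..n}"
  shows "G h * W k = \<zeta> ^ h (nx k) \<star> (W k * G h)"
proof -
  have "G h * (Yi k * G (ge k)) = inverse (\<zeta> ^ h k) \<star> (Yi k * (G h * G (ge k)))"
    using assms by (simp add: G_Yi flip: mult.assoc)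
  also have "\<dots> = \<zeta> ^ h (nx k) \<star> (Yi k * G (ge k) * G h)"
    using assms by (simp add: G_ge power_add mult.assoc flip: mult.assoc[of "inverse (\<zeta> ^ h k)"])
  finally show ?thesis by (simp add: W_def mult_ac)
qed

lemma ge_shift: "i \<in> {1..n} \<Longrightarrow> j \<in> {1..n} \<Longrightarrow> \<zeta> ^ (ge i (nx j) + ge j i) = 1"
  using n3 zpow_pred by (auto simp: gen_def nxt_def split: if_splits)

text \<open>Moving \<open>G (ge i)\<close> past \<open>W j\<close> costs
  \<open>\<zeta> ^ ge i (nx j)\<close>, and moving \<open>Yi i\<close> past \<open>G (ge j)\<close>
  costs \<open>\<zeta> ^ ge j i\<close>; by \<open>ge_shift\<close> the two scalars cancel.\<close>

lemma W_W:
  assumes "i \<in> {1..n}" "j \<in> {1..n}"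
  shows "W i * W j = W j * W i"
proof -
  have "W i * W j = (- t i / (\<zeta> - 1)) \<star> (Yi i * (G (ge i) * W j))"
    unfolding W_def[of i] by (simp add: mult.assoc)
  also have "\<dots> = ((- t i / (\<zeta> - 1)) * (- t j / (\<zeta> - 1)) * \<zeta> ^ ge i (nx j)) \<star> (Yi j * (Yi i * G (ge j)) * G (ge i))"
    using assms by (simp add: G_W) (simp add: W_def Yi_Yi[of i j] mult_ac[where ?'a = complex] flip: mult.assoc[where ?'a = "pt lop"])
  also have "Yi i * G (ge j) = \<zeta> ^ ge j i \<star> (G (ge j) * Yi i)"
    using assms by (simp add: G_Yi)
  finally show ?thesis using ge_shift[OF assms]
    by (simp add: power_add mult.assoc W_def)
qed

lemma G_X: "h \<in> Gset n l \<Longrightarrow> j \<in> {1..n} \<Longrightarrow> G h * X j = \<zeta> ^ h j \<star> (X j * G h)"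
  using pr_in[of j] nx_pr[of j] by (simp add: X_def distrib_left distrib_right G_Y G_W sc_simps)

text \<open>Products of two \<open>Y\<close> or of two \<open>W\<close> commute and drop out. The
  first mixed term can survive only if \<open>ge (pr j)\<close> moves x_i, that is for i = j or i =
  pr j; the second likewise with i and j exchanged.\<close>

lemma X_X:
  assumes "i \<in> {1..n}" "j \<in> {1..n}"
  shows "X i * X j - X j * X i = (1 - \<zeta> ^ ge (pr j) i) \<star> (Y i * W (pr j)) - (1 - \<zeta> ^ ge (pr i) j) \<star> (Y j * W (pr i))"
  using assms pr_in[of i] pr_in[of j] W_W[of "pr i" "pr j"]
  by (simp add: X_def distrib_left distrib_right W_Y sc_simps Y_Y[of i j])

lemma X_nx:
  assumes "i \<in> {1..n}"
  shows "X i * X (nx i) - X (nx i) * X i = t i \<star> G (ge i)"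
proof -
  have 1: "pr (nx i) = i" "ge i i = 1" "ge (pr i) (nx i) = 0"
    using assms n3 by (auto simp: pr_def gen_def nxt_def)
  have "(1 - \<zeta>) * t i / (\<zeta> - 1) = - t i" using zeta_neq_1 by (simp add: field_simps)
  then show ?thesis using X_X[OF assms nx_in[OF assms]] 1
    by (simp add: Y_W)
qed

lemma X_comm:
  assumes "i \<in> {1..n}" "j \<in> {1..n}" "j \<noteq> nx i" "i \<noteq> nx j"
  shows "X i * X j = X j * X i"
proof (cases "i = j")
  case False
  have 1: "ge (pr j) i = 0" "ge (pr i) j = 0"
    using assms False by (metis ge_val(3) nx_pr)+
  then show ?thesis using X_X[OF assms(1,2)] by simp
qed auto

section \<open>The representation of the twisted tensor algebra\<close>

abbreviation pm :: "nat list \<times> grp \<Rightarrow> nat list \<times> grp \<Rightarrow> nat list \<times> grp" where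
  "pm p q \<equiv> (fst p @ fst q, gm (snd p) (snd q))"

abbreviation co :: "nat list \<times> grp \<Rightarrow> nat list \<times> grp \<Rightarrow> complex" where
  "co p q \<equiv> al (snd p) (snd q) * chi \<zeta> (snd p) (fst q)"

definition E :: "nat list \<times> grp \<Rightarrow> pt lop" where
  "E p = prod_list (map X (fst p)) * G (snd p)"

definition \<phi> :: "elt \<Rightarrow> pt lop" where
  "\<phi> f = (\<Sum>x\<in>supp f. f x \<star> E x)"

definition pts :: "(nat list \<times> grp) set" where
  "pts = {(w, g). set w \<subseteq> {1..n} \<and> g \<in> Gset n l}"

text \<open>Both \<open>Alg\<close> and the degree filtration \<open>Algd\<close> are instances, so
  their closure properties are proved once.\<close>

definition Sp :: "(nat list \<times> grp) set \<Rightarrow> elt set" where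
  "Sp P = {f. finite (supp f) \<and> supp f \<subseteq> P}"

lemma Alg_Sp: "Alg n l = Sp pts"
  by (auto simp: Alg_def Sp_def pts_def supp_def)

lemma Sp_mono: "f \<in> Sp P \<Longrightarrow> P \<subseteq> Q \<Longrightarrow> f \<in> Sp Q"
  by (auto simp: Sp_def)

lemma fin_supp_Alg: "f \<in> Alg n l \<Longrightarrow> finite (supp f)"
  by (simp add: Alg_def)

lemma supp_sum: "supp (\<lambda>x. \<Sum>i\<in>I. f i x) \<subseteq> (\<Union>i\<in>I. supp (f i))"
  by (auto simp: supp_def dest: sum.not_neutral_contains_not_neutral)

lemma supp_add: "supp (add f g) \<subseteq> supp f \<union> supp g"
  and supp_sub: "supp (sub f g) \<subseteq> supp f \<union> supp g"
  and supp_smul: "supp (smul c f) \<subseteq> supp f"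
  by (auto simp: supp_def add_def sub_def smul_def)

lemma fin_add [simp]: "finite (supp f) \<Longrightarrow> finite (supp g) \<Longrightarrow> finite (supp (add f g))"
  and fin_sub [simp]: "finite (supp f) \<Longrightarrow> finite (supp g) \<Longrightarrow> finite (supp (sub f g))"
  and fin_smul [simp]: "finite (supp f) \<Longrightarrow> finite (supp (smul c f))"
  using supp_add supp_sub supp_smul by (meson finite_subset finite_UnI)+

lemma supp_basis [simp]: "supp (basis w g) = {(w, g)}"
  by (auto simp: supp_def basis_def)

lemma Sp_add: "f \<in> Sp P \<Longrightarrow> g \<in> Sp P \<Longrightarrow> add f g \<in> Sp P"
  and Sp_sub: "f \<in> Sp P \<Longrightarrow> g \<in> Sp P \<Longrightarrow> sub f g \<in> Sp P"
  and Sp_smul: "f \<in> Sp P \<Longrightarrow> smul c f \<in> Sp P"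
  using supp_add[of f g] supp_sub[of f g] supp_smul[of c f] by (auto simp: Sp_def)

lemma Sp_zero: "(\<lambda>_. 0) \<in> Sp P"
  by (simp add: Sp_def supp_def)

lemma Sp_sum: "finite I \<Longrightarrow> (\<And>i. i \<in> I \<Longrightarrow> f i \<in> Sp P) \<Longrightarrow> (\<lambda>x. \<Sum>i\<in>I. f i x) \<in> Sp P"
proof -
  assume I: "finite I" and f: "\<And>i. i \<in> I \<Longrightarrow> f i \<in> Sp P"
  have "finite (\<Union>i\<in>I. supp (f i))" "(\<Union>i\<in>I. supp (f i)) \<subseteq> P"
    using I f by (auto simp: Sp_def)
  then show ?thesis unfolding Sp_def
    by (intro CollectI conjI order_trans[OF supp_sum] finite_subset[OF supp_sum])
qed

lemma Sp_basis: "(w, g) \<in> P \<Longrightarrow> basis w g \<in> Sp P"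
  by (simp add: Sp_def)

text \<open>Summing over a fixed box \<open>A \<times> B\<close> with a conditional, instead of over
  the supports, lets products of different elements be compared termwise; bilinearity follows from
  it.\<close>

lemma mult_expand:
  assumes "finite A" "finite B" "supp f \<subseteq> A" "supp g \<subseteq> B"
  shows "(f \<odot> g) x = (\<Sum>(p, q)\<in>A \<times> B. if pm p q = x then f p * g q * co p q else 0)"
proof (cases x)
  case (Pair w k)
  let ?R = "{(p, q). p \<in> supp f \<and> q \<in> supp g \<and> fst p @ fst q = w \<and> gm (snd p) (snd q) = k}"
  have "(\<Sum>(p, q)\<in>A \<times> B. if pm p q = x then f p * g q * co p q else 0)
      = (\<Sum>(p, q)\<in>?R. f p * g q * co p q)"
    using assms Pair by (intro sum.mono_neutral_cong_right) (auto simp: supp_def split: if_splits)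
  then show ?thesis by (simp add: mult_def Pair mult.assoc)
qed

lemma mult_supp: "supp (f \<odot> g) \<subseteq> (\<lambda>(p, q). pm p q) ` (supp f \<times> supp g)"
proof
  fix x assume x: "x \<in> supp (f \<odot> g)"
  obtain w k where wk: "x = (w, k)" by force
  let ?R = "{(p, q). p \<in> supp f \<and> q \<in> supp g \<and> fst p @ fst q = w \<and> gm (snd p) (snd q) = k}"
  have "?R \<noteq> {}"
  proof
    assume e: "?R = {}"
    have "(f \<odot> g) x = 0" unfolding mult_def wk prod.case e by simp
    with x show False by (simp add: supp_def)
  qed
  then obtain p q where "p \<in> supp f" "q \<in> supp g" "pm p q = x" using wk by auto
  then show "x \<in> (\<lambda>(p, q). pm p q) ` (supp f \<times> supp g)" by force
qed

lemma fin_mult [simp]: "finite (supp f) \<Longrightarrow> finite (supp g) \<Longrightarrow> finite (supp (f \<odot> g))"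
  by (rule finite_subset[OF mult_supp]) simp

lemma Sp_mult:
  assumes "f \<in> Sp P" "g \<in> Sp Q" "\<And>p q. p \<in> P \<Longrightarrow> q \<in> Q \<Longrightarrow> pm p q \<in> R"
  shows "f \<odot> g \<in> Sp R"
proof -
  have "x \<in> R" if "x \<in> supp (f \<odot> g)" for x
  proof -
    have "x \<in> (\<lambda>(p, q). pm p q) ` (supp f \<times> supp g)"
      using that mult_supp by (rule rev_subsetD)
    then obtain p q where "x = pm p q" "p \<in> supp f" "q \<in> supp g" by (elim imageE SigmaE) simp
    then have "p \<in> P" "q \<in> Q" using assms(1,2) by (auto simp: Sp_def)
    then show ?thesis using assms(3) \<open>x = pm p q\<close> by simp
  qed
  then show ?thesis using assms by (auto simp: Sp_def)
qed

lemma pm_pts: "p \<in> pts \<Longrightarrow> q \<in> pts \<Longrightarrow> pm p q \<in> pts"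
  by (auto simp: pts_def)

lemma Alg_add [intro]: "f \<in> Alg n l \<Longrightarrow> g \<in> Alg n l \<Longrightarrow> add f g \<in> Alg n l"
  and Alg_sub [intro]: "f \<in> Alg n l \<Longrightarrow> g \<in> Alg n l \<Longrightarrow> sub f g \<in> Alg n l"
  and Alg_smul [intro]: "f \<in> Alg n l \<Longrightarrow> smul c f \<in> Alg n l"
  and Alg_zero [intro]: "(\<lambda>_. 0) \<in> Alg n l"
  by (simp_all add: Alg_Sp Sp_add Sp_sub Sp_smul Sp_zero)

lemma Alg_sum: "finite I \<Longrightarrow> (\<And>i. i \<in> I \<Longrightarrow> f i \<in> Alg n l) \<Longrightarrow> (\<lambda>x. \<Sum>i\<in>I. f i x) \<in> Alg n l"
  by (simp add: Alg_Sp Sp_sum)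

lemma Alg_basis [intro]: "set w \<subseteq> {1..n} \<Longrightarrow> g \<in> Gset n l \<Longrightarrow> basis w g \<in> Alg n l"
  unfolding Alg_Sp by (intro Sp_basis) (auto simp: pts_def)

lemma Alg_mult [intro]: "f \<in> Alg n l \<Longrightarrow> g \<in> Alg n l \<Longrightarrow> f \<odot> g \<in> Alg n l"
  unfolding Alg_Sp by (erule (1) Sp_mult) (rule pm_pts)

lemma mult_lin:
  assumes "finite (supp f)" "finite (supp g)" "finite (supp h)"
  shows mult_add_right: "f \<odot> add g h = add (f \<odot> g) (f \<odot> h)"
    and mult_sub_right: "f \<odot> sub g h = sub (f \<odot> g) (f \<odot> h)"
    and mult_smul_right: "f \<odot> smul c g = smul c (f \<odot> g)"
    and mult_add_left: "add g h \<odot> f = add (g \<odot> f) (h \<odot> f)"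
    and mult_sub_left: "sub g h \<odot> f = sub (g \<odot> f) (h \<odot> f)"
    and mult_smul_left: "smul c g \<odot> f = smul c (g \<odot> f)"
proof -
  let ?A = "supp f" and ?B = "supp g \<union> supp h"
  note e1 = mult_expand[of ?A ?B] and e2 = mult_expand[of ?B ?A]
  note s = supp_add[of g h] supp_sub[of g h] supp_smul[of c g]
  have fin: "finite ?A" "finite ?B" using assms by auto
  show "f \<odot> add g h = add (f \<odot> g) (f \<odot> h)"
  proof
    fix x
    have "(f \<odot> add g h) x = (f \<odot> g) x + (f \<odot> h) x"
      using fin s unfolding e1[OF fin subset_refl s(1)] e1[OF fin subset_refl Un_upper1] e1[OF fin subset_refl Un_upper2]
        sum.distrib[symmetric]
      by (intro sum.cong) (auto simp: add_def algebra_simps)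
    then show "(f \<odot> add g h) x = add (f \<odot> g) (f \<odot> h) x" by (simp add: add_def)
  qed
  show "f \<odot> sub g h = sub (f \<odot> g) (f \<odot> h)"
  proof
    fix x
    have "(f \<odot> sub g h) x = (f \<odot> g) x - (f \<odot> h) x"
      using fin s unfolding e1[OF fin subset_refl s(2)] e1[OF fin subset_refl Un_upper1] e1[OF fin subset_refl Un_upper2]
        sum_subtractf[symmetric]
      by (intro sum.cong) (auto simp: sub_def algebra_simps)
    then show "(f \<odot> sub g h) x = sub (f \<odot> g) (f \<odot> h) x" by (simp add: sub_def)
  qed
  show "f \<odot> smul c g = smul c (f \<odot> g)"
  proof
    fix x
    have "(f \<odot> smul c g) x = c * (f \<odot> g) x"
      using fin s unfolding e1[OF fin subset_refl order_trans[OF s(3) Un_upper1]] e1[OF fin subset_refl Un_upper1]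
        sum_distrib_left
      by (intro sum.cong) (auto simp: smul_def algebra_simps)
    then show "(f \<odot> smul c g) x = smul c (f \<odot> g) x" by (simp add: smul_def)
  qed
  show "add g h \<odot> f = add (g \<odot> f) (h \<odot> f)"
  proof
    fix x
    have "(add g h \<odot> f) x = (g \<odot> f) x + (h \<odot> f) x"
      using fin s unfolding e2[OF fin(2,1) s(1) subset_refl] e2[OF fin(2,1) Un_upper1 subset_refl] e2[OF fin(2,1) Un_upper2 subset_refl]
        sum.distrib[symmetric]
      by (intro sum.cong) (auto simp: add_def algebra_simps)
    then show "(add g h \<odot> f) x = add (g \<odot> f) (h \<odot> f) x" by (simp add: add_def)
  qed
  show "sub g h \<odot> f = sub (g \<odot> f) (h \<odot> f)"
  proof
    fix x
    have "(sub g h \<odot> f) x = (g \<odot> f) x - (h \<odot> f) x"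
      using fin s unfolding e2[OF fin(2,1) s(2) subset_refl] e2[OF fin(2,1) Un_upper1 subset_refl] e2[OF fin(2,1) Un_upper2 subset_refl]
        sum_subtractf[symmetric]
      by (intro sum.cong) (auto simp: sub_def algebra_simps)
    then show "(sub g h \<odot> f) x = sub (g \<odot> f) (h \<odot> f) x" by (simp add: sub_def)
  qed
  show "smul c g \<odot> f = smul c (g \<odot> f)"
  proof
    fix x
    have "(smul c g \<odot> f) x = c * (g \<odot> f) x"
      using fin s unfolding e2[OF fin(2,1) order_trans[OF s(3) Un_upper1] subset_refl] e2[OF fin(2,1) Un_upper1 subset_refl]
        sum_distrib_left
      by (intro sum.cong) (auto simp: smul_def algebra_simps)
    then show "(smul c g \<odot> f) x = smul c (g \<odot> f) x" by (simp add: smul_def)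
  qed
qed

lemma mult_smul:
  assumes "finite (supp f)" "finite (supp g)"
  shows "f \<odot> smul c g = smul c (f \<odot> g)" "smul c f \<odot> g = smul c (f \<odot> g)"
  using mult_smul_right[OF assms assms(2)] mult_smul_left[OF assms(2,1,1)] by auto

lemma mult_basis: "basis w g \<odot> basis v h = smul (al g h * chi \<zeta> g v) (basis (w @ v) (gm g h))"
proof
  fix x
  show "(basis w g \<odot> basis v h) x = smul (al g h * chi \<zeta> g v) (basis (w @ v) (gm g h)) x"
    by (subst mult_expand[of "{(w, g)}" "{(v, h)}"]) (simp_all, auto simp: basis_def smul_def)
qed

lemma chi_gunit [simp]: "chi \<zeta> gunit w = 1"
  by (induction w) (auto simp: chi_def gunit_def)

lemma chi_Nil [simp]: "chi \<zeta> g [] = 1" and chi_Cons: "chi \<zeta> g (i # w) = \<zeta> ^ g i * chi \<zeta> g w"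
  by (simp_all add: chi_def power_add)

lemma smul_one [simp]: "smul 1 f = f" and smul_smul [simp]: "smul a (smul b f) = smul (a * b) f"
  by (auto simp: smul_def)

section \<open>The map \<open>\<phi>\<close> is multiplicative and kills the ideal\<close>

lemma phi_superset: "finite A \<Longrightarrow> supp f \<subseteq> A \<Longrightarrow> \<phi> f = (\<Sum>x\<in>A. f x \<star> E x)"
  unfolding \<phi>_def by (intro sum.mono_neutral_left) (auto simp: supp_def)

lemma phi_basis [simp]: "\<phi> (basis w g) = E (w, g)"
  by (simp add: \<phi>_def) (simp add: basis_def)

lemma phi_add: "finite (supp f) \<Longrightarrow> finite (supp g) \<Longrightarrow> \<phi> (add f g) = \<phi> f + \<phi> g"
  by (simp add: phi_superset[of "supp f \<union> supp g"] supp_add)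
    (simp add: add_def sc_add_left sum.distrib)

lemma phi_sub: "finite (supp f) \<Longrightarrow> finite (supp g) \<Longrightarrow> \<phi> (sub f g) = \<phi> f - \<phi> g"
  by (simp add: phi_superset[of "supp f \<union> supp g"] supp_sub)
    (simp add: sub_def sc_diff_left sum_subtractf)

lemma phi_smul: "finite (supp f) \<Longrightarrow> \<phi> (smul c f) = c \<star> \<phi> f"
  by (simp add: phi_superset[of "supp f"] supp_smul) (simp add: smul_def sc_sum)

lemma phi_zero [simp]: "\<phi> (\<lambda>_. 0) = 0"
  by (simp add: \<phi>_def)

lemma phi_sum:
  assumes "finite I" "\<And>i. i \<in> I \<Longrightarrow> finite (supp (f i))"
  shows "\<phi> (\<lambda>x. \<Sum>i\<in>I. f i x) = (\<Sum>i\<in>I. \<phi> (f i))"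
proof -
  let ?A = "\<Union>i\<in>I. supp (f i)"
  have A: "finite ?A" using assms by auto
  have "\<phi> (\<lambda>x. \<Sum>i\<in>I. f i x) = (\<Sum>x\<in>?A. \<Sum>i\<in>I. f i x \<star> E x)"
    by (simp add: phi_superset[OF A supp_sum] sum_sc)
  also have "\<dots> = (\<Sum>i\<in>I. \<Sum>x\<in>?A. f i x \<star> E x)" by (rule sum.swap)
  also have "\<dots> = (\<Sum>i\<in>I. \<phi> (f i))"
    by (intro sum.cong refl phi_superset[OF A, symmetric]) auto
  finally show ?thesis .
qed

lemma G_Xs:
  assumes "set w \<subseteq> {1..n}" "g \<in> Gset n l"
  shows "G g * prod_list (map X w) = chi \<zeta> g w \<star> (prod_list (map X w) * G g)"
  using assms(1)
proof (induction w)
  case (Cons i w)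
  have "G g * (X i * prod_list (map X w)) = \<zeta> ^ g i \<star> (X i * (G g * prod_list (map X w)))"
    using Cons.prems assms by (simp add: G_X flip: mult.assoc)
  with Cons show ?case by (simp add: chi_Cons mult.assoc)
qed simp

text \<open>Moving \<open>G g\<close> across the second word produces \<open>chi\<close>, and
  \<open>G_G\<close> produces \<open>alpha\<close>; these are the structure constants of
  \<open>mult\<close>, which makes \<open>\<phi>\<close> multiplicative.\<close>

lemma E_E:
  assumes "p \<in> pts" "q \<in> pts"
  shows "E p * E q = co p q \<star> E (pm p q)"
proof -
  obtain w g v h where pq: "p = (w, g)" "q = (v, h)" by fastforce
  have "E p * E q = prod_list (map X w) * (G g * prod_list (map X v)) * G h"
    by (simp add: E_def pq mult.assoc)
  also have "\<dots> = chi \<zeta> g v \<star> (prod_list (map X w) * prod_list (map X v) * (G g * G h))"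
    using assms pq by (simp add: G_Xs pts_def mult.assoc)
  finally show ?thesis by (simp add: pq E_def G_G mult.commute)
qed

lemma phi_mult:
  assumes "f \<in> Alg n l" "g \<in> Alg n l"
  shows "\<phi> (f \<odot> g) = \<phi> f * \<phi> g"
proof -
  let ?A = "supp f" and ?B = "supp g"
  let ?C = "(\<lambda>(p, q). pm p q) ` (?A \<times> ?B)"
  have fin: "finite ?A" "finite ?B" using assms by (simp_all add: fin_supp_Alg)
  have sub: "?A \<subseteq> pts" "?B \<subseteq> pts" using assms by (auto simp: Alg_Sp Sp_def)
  have "\<phi> (f \<odot> g) = (\<Sum>x\<in>?C. (f \<odot> g) x \<star> E x)"
    using fin by (intro phi_superset mult_supp) auto
  also have "\<dots> = (\<Sum>x\<in>?C. \<Sum>(p, q)\<in>?A \<times> ?B. if pm p q = x then (f p * g q) \<star> (E p * E q) else 0)"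
  proof (rule sum.cong[OF refl])
    fix x
    show "(f \<odot> g) x \<star> E x = (\<Sum>(p, q)\<in>?A \<times> ?B. if pm p q = x then (f p * g q) \<star> (E p * E q) else 0)"
      unfolding mult_expand[OF fin subset_refl subset_refl] sum_sc
      using sub by (intro sum.cong refl) (auto simp: E_E[OF subsetD[OF sub(1)] subsetD[OF sub(2)]])
  qed
  also have "\<dots> = (\<Sum>(p, q)\<in>?A \<times> ?B. \<Sum>x\<in>?C. if pm p q = x then (f p * g q) \<star> (E p * E q) else 0)"
    by (subst sum.swap) (simp add: case_prod_unfold)
  also have "\<dots> = (\<Sum>(p, q)\<in>?A \<times> ?B. (f p * g q) \<star> (E p * E q))"
  proof (rule sum.cong[OF refl])
    fix z assume z: "z \<in> ?A \<times> ?B"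
    have "finite ?C" using fin by simp
    obtain p q where pq: "z = (p, q)" by (rule prod.exhaust)
    have "pm p q \<in> ?C" by (rule image_eqI[of _ _ "(p, q)"]) (use z pq in auto)
    then show "(case z of (p, q) \<Rightarrow> \<Sum>x\<in>?C. if pm p q = x then (f p * g q) \<star> (E p * E q) else 0)
        = (case z of (p, q) \<Rightarrow> (f p * g q) \<star> (E p * E q))"
      unfolding pq prod.case by (simp only: sum.delta'[OF \<open>finite ?C\<close>] if_True)
  qed
  also have "\<dots> = (\<Sum>p\<in>?A. \<Sum>q\<in>?B. (f p \<star> E p) * (g q \<star> E q))"
    by (simp add: sum.cartesian_product mult.commute[where ?'a = complex])
  also have "\<dots> = \<phi> f * \<phi> g"
    by (simp add: \<phi>_def sum_product)
  finally show ?thesis .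
qed

lemma one_Alg [simp]: "one \<in> Alg n l" and phi_one [simp]: "\<phi> one = 1"
  by (auto simp: one_def E_def)

lemma xv_Alg [simp]: "j \<in> {1..n} \<Longrightarrow> xv j \<in> Alg n l" and phi_xv [simp]: "\<phi> (xv j) = X j"
  by (auto simp: xv_def E_def)

lemma gv_Alg [simp]: "k \<in> {1..n} \<Longrightarrow> gv n l k \<in> Alg n l" and phi_gv [simp]: "\<phi> (gv n l k) = G (ge k)"
  by (auto simp: gv_def E_def)

lemma xv_xv: "xv i \<odot> xv j = basis [i, j] gunit"
  by (simp add: xv_def mult_basis)

lemma Rels_Alg: "r \<in> Rels n l \<zeta> t \<Longrightarrow> r \<in> Alg n l"
  unfolding Rels_def
  by (elim UnE CollectE exE conjE; hypsubst) (intro Alg_sub Alg_mult Alg_smul xv_Alg gv_Alg nx_in; assumption)+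

lemma Ideal_Alg: "a \<in> Ideal n l \<zeta> t \<Longrightarrow> a \<in> Alg n l"
  by (induction rule: Ideal.induct) (auto dest: Rels_Alg)

lemma not_adj:
  assumes "i \<in> {1..n}" "j \<in> {1..n}"
  shows "\<bar>int i - int j\<bar> \<notin> {1, int n - 1} \<longleftrightarrow> j \<noteq> nx i \<and> i \<noteq> nx j"
  using assms n3 by (auto simp: nxt_def abs_if split: if_splits)

lemma phi_Rels: "r \<in> Rels n l \<zeta> t \<Longrightarrow> \<phi> r = 0"
  unfolding Rels_def
proof (elim UnE CollectE exE conjE)
  fix i
  assume r: "r = sub (sub (xv i \<odot> xv (nx i)) (xv (nx i) \<odot> xv i)) (smul (t i) (gv n l i))" and i: "i \<in> {1..n}"
  show "\<phi> r = 0"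
    using i nx_in[OF i] X_nx[OF i] unfolding r
    by (simp add: phi_sub phi_smul phi_mult fin_supp_Alg Alg_mult Alg_sub)
next
  fix i j
  assume r: "r = sub (xv i \<odot> xv j) (xv j \<odot> xv i)" and i: "i \<in> {1..n}" and j: "j \<in> {1..n}"
    and a: "\<bar>int i - int j\<bar> \<notin> {1, int n - 1}"
  show "\<phi> r = 0"
    using i j X_comm[of i j] a unfolding r not_adj[OF i j]
    by (simp add: phi_sub phi_mult fin_supp_Alg Alg_mult)
qed

lemma phi_Ideal: "a \<in> Ideal n l \<zeta> t \<Longrightarrow> \<phi> a = 0"
  by (induction rule: Ideal.induct)
    (auto simp: phi_Rels phi_add phi_smul phi_mult Ideal_Alg fin_supp_Alg)

section \<open>Linear independence of ordered monomials\<close>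

text \<open>The bound is strict so that \<open>Algd 0\<close> is the zero space, from which the
  inductions on the degree start.\<close>

definition Algd :: "nat \<Rightarrow> elt set" where
  "Algd d = Sp (pts \<inter> {p. length (fst p) < d})"

text \<open>Congruence modulo \<open>Q d\<close> is equality in H up to terms of degree less than \<open>d\<close>.\<close>

definition Q :: "nat \<Rightarrow> elt set" where
  "Q d = {f. \<exists>i\<in>Ideal n l \<zeta> t. \<exists>r\<in>Algd d. f = add i r}"

lemma Algd_Alg: "f \<in> Algd d \<Longrightarrow> f \<in> Alg n l"
  unfolding Algd_def Alg_Sp by (erule Sp_mono) simp

lemma suppD: "f \<in> Alg n l \<Longrightarrow> (w, g) \<in> supp f \<Longrightarrow> set w \<subseteq> {1..n} \<and> g \<in> Gset n l"
  by (simp add: Alg_def supp_def)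

lemma supp_lengthD: "f \<in> Algd d \<Longrightarrow> (w, g) \<in> supp f \<Longrightarrow> length w < d"
  by (auto simp: Algd_def Sp_def)

lemma Algd_mono: "f \<in> Algd d \<Longrightarrow> d \<le> d' \<Longrightarrow> f \<in> Algd d'"
  unfolding Algd_def by (erule Sp_mono) auto

lemma Alg_Algd:
  assumes "f \<in> Alg n l"
  obtains d where "f \<in> Algd d"
proof
  have fin: "finite (length ` fst ` supp f)" using assms by (simp add: fin_supp_Alg)
  have "length (fst p) < Suc (Max (length ` fst ` supp f))" if "p \<in> supp f" for p
    unfolding less_Suc_eq_le by (rule Max_ge[OF fin]) (use that in simp)
  then show "f \<in> Algd (Suc (Max (length ` fst ` supp f)))"
    using assms by (auto simp: Algd_def Alg_Sp Sp_def)
qed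

lemma Algd_basis: "length w < d \<Longrightarrow> set w \<subseteq> {1..n} \<Longrightarrow> g \<in> Gset n l \<Longrightarrow> basis w g \<in> Algd d"
  unfolding Algd_def by (intro Sp_basis) (auto simp: pts_def)

lemma Algd_mult:
  assumes "f \<in> Algd a" "g \<in> Algd b"
  shows "f \<odot> g \<in> Algd (a + b - 1)"
  using assms unfolding Algd_def
  by (rule Sp_mult) (use pm_pts in auto)

lemma Algd_add: "f \<in> Algd d \<Longrightarrow> g \<in> Algd d \<Longrightarrow> add f g \<in> Algd d"
  and Algd_sub: "f \<in> Algd d \<Longrightarrow> g \<in> Algd d \<Longrightarrow> sub f g \<in> Algd d"
  and Algd_smul: "f \<in> Algd d \<Longrightarrow> smul c f \<in> Algd d"
  and Algd_zero: "(\<lambda>_. 0) \<in> Algd d"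
  by (simp_all add: Algd_def Sp_add Sp_sub Sp_smul Sp_zero)

lemma Q_Ideal: "f \<in> Ideal n l \<zeta> t \<Longrightarrow> f \<in> Q d"
  and Q_Algd: "f \<in> Algd d \<Longrightarrow> f \<in> Q d"
proof -
  have z: "f = add f (\<lambda>_. 0)" "f = add (\<lambda>_. 0) f" by (simp_all add: add_def)
  show "f \<in> Ideal n l \<zeta> t \<Longrightarrow> f \<in> Q d" "f \<in> Algd d \<Longrightarrow> f \<in> Q d"
    unfolding Q_def using z Algd_zero Ideal.zero by blast+
qed

lemma Q_add: "f \<in> Q d \<Longrightarrow> g \<in> Q d \<Longrightarrow> add f g \<in> Q d"
proof -
  assume "f \<in> Q d" "g \<in> Q d"
  then obtain i r j s where *: "i \<in> Ideal n l \<zeta> t" "r \<in> Algd d" "f = add i r"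
    "j \<in> Ideal n l \<zeta> t" "s \<in> Algd d" "g = add j s" by (auto simp: Q_def)
  have "add f g = add (add i j) (add r s)" using * by (simp add: add_def ac_simps)
  then show ?thesis unfolding Q_def using * Ideal.add Algd_add by blast
qed

lemma Q_smul: "f \<in> Q d \<Longrightarrow> smul c f \<in> Q d"
proof -
  assume "f \<in> Q d"
  then obtain i r where *: "i \<in> Ideal n l \<zeta> t" "r \<in> Algd d" "f = add i r" by (auto simp: Q_def)
  have "smul c f = add (smul c i) (smul c r)" using * by (simp add: add_def smul_def algebra_simps)
  then show ?thesis unfolding Q_def using * Ideal.smul Algd_smul by blast
qed

lemma sub_alt: "sub f g = add f (smul (-1) g)"
  by (simp add: sub_def add_def smul_def)

lemma Q_sub: "f \<in> Q d \<Longrightarrow> g \<in> Q d \<Longrightarrow> sub f g \<in> Q d"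
  by (simp add: sub_alt Q_add Q_smul)

lemma Q_sum: "finite I \<Longrightarrow> (\<And>i. i \<in> I \<Longrightarrow> f i \<in> Q d) \<Longrightarrow> (\<lambda>x. \<Sum>i\<in>I. f i x) \<in> Q d"
proof (induction I rule: finite_induct)
  case empty
  then show ?case by (simp add: Q_Algd Algd_zero)
next
  case (insert i I)
  then have "add (f i) (\<lambda>x. \<Sum>i\<in>I. f i x) \<in> Q d" by (simp add: Q_add)
  then show ?case using insert.hyps by (simp add: add_def)
qed

text \<open>Since \<open>Algd (Suc e)\<close> means degree at most e, multiplication by g shifts the
  filtration by e, while the ideal part stays in the ideal.\<close>

lemma Q_mult:
  assumes "f \<in> Q d" "g \<in> Algd (Suc e)"
  shows "f \<odot> g \<in> Q (d + e)" "g \<odot> f \<in> Q (d + e)"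
proof -
  obtain i r where *: "i \<in> Ideal n l \<zeta> t" "r \<in> Algd d" "f = add i r" using assms by (auto simp: Q_def)
  have g: "g \<in> Alg n l" using assms(2) by (rule Algd_Alg)
  have fin: "finite (supp i)" "finite (supp r)" "finite (supp g)"
    using * g by (simp_all add: fin_supp_Alg Ideal_Alg Algd_Alg)
  have "r \<odot> g \<in> Algd (d + e)" "g \<odot> r \<in> Algd (d + e)"
    using Algd_mult[OF *(2) assms(2)] Algd_mult[OF assms(2) *(2)] by (simp_all add: add.commute)
  then show "f \<odot> g \<in> Q (d + e)" "g \<odot> f \<in> Q (d + e)"
    using *(1) g fin by (simp_all add: *(3) mult_add_left mult_add_right Q_add Q_Algd Q_Ideal Ideal.lmult Ideal.rmult)
qed

section \<open>Reordering letters modulo lower degree\<close>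

lemma rel_basis:
  assumes "i \<in> {1..n}" "j \<in> {1..n}"
  obtains c k where "k \<in> {1..n}"
    "sub (sub (basis [i, j] gunit) (basis [j, i] gunit)) (smul c (basis [] (ge k))) \<in> Ideal n l \<zeta> t"
proof -
  have R: "sub (sub (basis [i, nx i] gunit) (basis [nx i, i] gunit)) (smul (t i) (basis [] (ge i))) \<in> Ideal n l \<zeta> t"
    if "i \<in> {1..n}" for i
    by (rule Ideal.rel) (use that in \<open>auto simp: Rels_def xv_xv gv_def\<close>)
  show thesis
  proof (cases "j = nx i \<or> i = nx j")
    case True
    then show thesis
    proof
      assume "j = nx i"
      with R[OF assms(1)] that[OF assms(1)] show thesis by simp
    next
      assume i: "i = nx j"
      have "sub (sub (basis [i, j] gunit) (basis [j, i] gunit)) (smul (- t j) (basis [] (ge j)))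
        = smul (-1) (sub (sub (basis [j, nx j] gunit) (basis [nx j, j] gunit)) (smul (t j) (basis [] (ge j))))"
        unfolding i by (simp add: sub_def smul_def fun_eq_iff)
      with Ideal.smul[OF R[OF assms(2)], of "-1"] that[OF assms(2)] show thesis by metis
    qed
  next
    case False
    then have "sub (xv i \<odot> xv j) (xv j \<odot> xv i) \<in> Rels n l \<zeta> t"
      unfolding Rels_def using assms not_adj[OF assms] by blast
    then have "sub (basis [i, j] gunit) (basis [j, i] gunit) \<in> Ideal n l \<zeta> t"
      unfolding xv_xv by (rule Ideal.rel)
    \<comment> \<open>Commuting letters are the case c = 0; the choice k = i is then
      arbitrary.\<close>
    then have "sub (sub (basis [i, j] gunit) (basis [j, i] gunit)) (smul 0 (basis [] (ge i))) \<in> Ideal n l \<zeta> t"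
      by (simp add: sub_def smul_def)
    with that[OF assms(1)] show thesis by metis
  qed
qed

text \<open>Multiplying a relation by u on the left and by v g on the right leaves, besides the two
  words, a multiple of a word two letters shorter; its scalar c' collects c together with characters
  and cocycle values.\<close>

lemma swap_Q:
  assumes ij: "i \<in> {1..n}" "j \<in> {1..n}" and uv: "set u \<subseteq> {1..n}" "set v \<subseteq> {1..n}" and g: "g \<in> Gset n l"
  shows "sub (basis (u @ i # j # v) g) (basis (u @ j # i # v) g) \<in> Q (length u + length v + 2)"
proof -
  obtain c k where k: "k \<in> {1..n}" and
    R: "sub (sub (basis [i, j] gunit) (basis [j, i] gunit)) (smul c (basis [] (ge k))) \<in> Ideal n l \<zeta> t"
    (is "?R \<in> _") using rel_basis[OF ij] .
  have "basis u gunit \<odot> ?R \<odot> basis v g \<in> Ideal n l \<zeta> t"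
    by (intro Ideal.lmult Ideal.rmult R Alg_basis uv g Gset_gunit)
  moreover
  obtain c' where "basis u gunit \<odot> ?R \<odot> basis v g
    = sub (sub (basis (u @ i # j # v) g) (basis (u @ j # i # v) g)) (smul c' (basis (u @ v) (gm (ge k) g)))"
    using k g by (simp add: mult_basis mult_sub_left mult_sub_right mult_smul)
  ultimately have I: "sub (sub (basis (u @ i # j # v) g) (basis (u @ j # i # v) g)) (smul c' (basis (u @ v) (gm (ge k) g)))
     \<in> Ideal n l \<zeta> t" (is "sub ?A ?B \<in> _") by simp
  have "?A = add (sub ?A ?B) ?B" by (simp add: sub_def add_def)
  moreover have "?B \<in> Algd (length u + length v + 2)"
    using k g uv by (intro Algd_smul Algd_basis) auto
  ultimately show ?thesis using I by (metis Q_add Q_Ideal Q_Algd)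
qed

lemma Q_sub_trans: "sub f g \<in> Q d \<Longrightarrow> sub g h \<in> Q d \<Longrightarrow> sub f h \<in> Q d"
proof -
  assume "sub f g \<in> Q d" "sub g h \<in> Q d"
  then have "add (sub f g) (sub g h) \<in> Q d" by (rule Q_add)
  then show ?thesis by (simp add: sub_def add_def)
qed

lemma Q_sub_refl: "sub f f \<in> Q d"
  using Q_Algd[OF Algd_zero] by (simp add: sub_def)

lemma move_Q:
  assumes "x \<in> {1..n}" "set u \<subseteq> {1..n}" "g \<in> Gset n l"
  shows "set a \<subseteq> {1..n} \<Longrightarrow> set b \<subseteq> {1..n} \<Longrightarrow>
    sub (basis (u @ a @ x # b) g) (basis (u @ x # a @ b) g) \<in> Q (length u + length a + length b + 1)"
proof (induction a arbitrary: b rule: rev_induct)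
  case Nil
  then show ?case by (simp add: Q_sub_refl)
next
  case (snoc y a)
  have "sub (basis ((u @ a) @ y # x # b) g) (basis ((u @ a) @ x # y # b) g) \<in> Q (length (u @ a) + length b + 2)"
    using snoc.prems assms by (intro swap_Q) auto
  moreover have "sub (basis (u @ a @ x # (y # b)) g) (basis (u @ x # a @ (y # b)) g) \<in> Q (length u + length a + length (y # b) + 1)"
    using snoc.prems assms by (intro snoc.IH) auto
  ultimately show ?case by (auto intro: Q_sub_trans)
qed

text \<open>The prefix u carries the letters already in place: the first letter of w is moved to the
  front of w' by \<open>move_Q\<close> and then joins the prefix.\<close>

lemma perm_Q:
  assumes "g \<in> Gset n l"
  shows "mset w = mset w' \<Longrightarrow> set w \<subseteq> {1..n} \<Longrightarrow> set u \<subseteq> {1..n} \<Longrightarrow>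
    sub (basis (u @ w) g) (basis (u @ w') g) \<in> Q (length u + length w)"
proof (induction w arbitrary: u w')
  case Nil
  then show ?case by (simp add: Q_sub_refl)
next
  case (Cons x w)
  have "x \<in> set w'" using Cons.prems(1) by (metis list.set_intros(1) set_mset_mset)
  then obtain a b where w': "w' = a @ x # b" by (auto simp: in_set_conv_decomp)
  have m: "mset w = mset (a @ b)" using Cons.prems(1) w' by simp
  have s: "set (a @ b) \<subseteq> {1..n}" "length (a @ b) = length w"
    using m Cons.prems(2) by (metis set_mset_mset set_subset_Cons order_trans, metis size_mset)
  have 1: "sub (basis ((u @ [x]) @ w) g) (basis ((u @ [x]) @ a @ b) g) \<in> Q (length (u @ [x]) + length w)"
    using Cons.prems m by (intro Cons.IH) auto
  have len: "length u + length a + length b + 1 = length u + length (x # w)"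
    using s(2) by simp
  have "smul (-1) (sub (basis (u @ a @ x # b) g) (basis (u @ x # a @ b) g)) \<in> Q (length u + length a + length b + 1)"
    using Cons.prems s assms by (intro Q_smul move_Q) auto
  then have "sub (basis (u @ x # a @ b) g) (basis (u @ a @ x # b) g) \<in> Q (length u + length (x # w))"
    unfolding len by (simp add: sub_def smul_def)
  with 1 show ?case unfolding w' by (auto intro: Q_sub_trans)
qed

text \<open>For \<open>size M = d\<close> this is the coefficient of \<open>x^M g\<close> in the image of an element of degree at most \<open>d\<close>
  in the associated graded algebra.\<close>

definition symb :: "elt \<Rightarrow> nat multiset \<Rightarrow> grp \<Rightarrow> complex" where
  "symb z M g = (\<Sum>w | mset w = M. z (w, g))"

definition nf :: "nat multiset \<Rightarrow> grp \<Rightarrow> elt" where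
  "nf M g = basis (sorted_list_of_multiset M) g"

lemma finite_mset_eq: "finite {w. mset w = M}"
proof (rule finite_subset)
  show "{w. mset w = M} \<subseteq> {w. set w \<subseteq> set_mset M \<and> length w = size M}" by auto
  show "finite {w. set w \<subseteq> set_mset M \<and> length w = size M}"
    by (rule finite_lists_length_eq) simp
qed

text \<open>A finite index set for the degree d part; cancellation may make \<open>symb z\<close>
  vanish at some of its pairs.\<close>

definition topset :: "nat \<Rightarrow> elt \<Rightarrow> (nat multiset \<times> grp) set" where
  "topset d z = (\<lambda>(w, g). (mset w, g)) ` {y \<in> supp z. length (fst y) = d}"

lemma topset_finite: "z \<in> Alg n l \<Longrightarrow> finite (topset d z)"
  by (simp add: topset_def fin_supp_Alg)

lemma topset_D: "z \<in> Alg n l \<Longrightarrow> (M, g) \<in> topset d z \<Longrightarrow> size M = d \<and> set_mset M \<subseteq> {1..n} \<and> g \<in> Gset n l"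
  unfolding topset_def by (auto dest!: suppD)

lemma reduce_Q:
  assumes z: "z \<in> Algd (Suc d)"
  shows "sub z (\<lambda>x. \<Sum>(M, g)\<in>topset d z. symb z M g * nf M g x) \<in> Q d"
proof -
  let ?Z = "supp z" and ?Zd = "{y \<in> supp z. length (fst y) = d}"
  let ?m = "\<lambda>(w, g). (mset w, g) :: nat multiset \<times> grp"
  have za: "z \<in> Alg n l" using z by (rule Algd_Alg)
  have fin: "finite ?Z" using za by (rule fin_supp_Alg)
  \<comment> \<open>Modulo \<open>Q d\<close> a word of length d reduces to its sorted form and a
    shorter word to 0.\<close>
  define b where "b y = (if length (fst y) = d then nf (mset (fst y)) (snd y) else (\<lambda>_. 0))" for y :: "nat list \<times> grp"
  have diff: "sub (basis (fst y) (snd y)) (b y) \<in> Q d" if y: "y \<in> ?Z" for y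
  proof -
    have yp: "set (fst y) \<subseteq> {1..n}" "snd y \<in> Gset n l" "length (fst y) \<le> d"
      using suppD[OF za, of "fst y" "snd y"] supp_lengthD[OF z, of "fst y" "snd y"] y by simp_all
    show ?thesis
    proof (cases "length (fst y) = d")
      case True
      then show ?thesis
        using perm_Q[OF yp(2), of "fst y" "sorted_list_of_multiset (mset (fst y))" "[]"] yp
        by (simp add: b_def nf_def)
    next
      case False
      then have "basis (fst y) (snd y) \<in> Q d" using yp by (intro Q_Algd Algd_basis) auto
      then show ?thesis using False by (simp add: b_def sub_def)
    qed
  qed
  have 1: "z x = (\<Sum>y\<in>?Z. z y * basis (fst y) (snd y) x)" for x
  proof -
    have "(\<Sum>y\<in>?Z. z y * basis (fst y) (snd y) x) = (\<Sum>y\<in>?Z. if x = y then z y else 0)"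
      by (intro sum.cong) (auto simp: basis_def)
    also have "\<dots> = z x" using fin by (simp add: sum.delta) (simp add: supp_def)
    finally show ?thesis by simp
  qed
  have 2: "(\<Sum>y\<in>?Z. z y * b y x) = (\<Sum>(M, g)\<in>topset d z. symb z M g * nf M g x)" for x
  proof -
    have "(\<Sum>y\<in>?Z. z y * b y x) = (\<Sum>y\<in>?Zd. z y * nf (mset (fst y)) (snd y) x)"
      using fin by (intro sum.mono_neutral_cong_right) (auto simp: b_def)
    also have "\<dots> = (\<Sum>q\<in>topset d z. \<Sum>y\<in>{y \<in> ?Zd. ?m y = q}. z y * nf (mset (fst y)) (snd y) x)"
      unfolding topset_def using fin by (intro sum.image_gen) simp
    also have "\<dots> = (\<Sum>(M, g)\<in>topset d z. symb z M g * nf M g x)"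
    proof (rule sum.cong[OF refl])
      fix q assume q: "q \<in> topset d z"
      obtain M g where Mg: "q = (M, g)" by force
      have M: "size M = d" using q Mg topset_D[OF za] by auto
      have "(\<Sum>y\<in>{y \<in> ?Zd. ?m y = q}. z y * nf (mset (fst y)) (snd y) x)
          = (\<Sum>y\<in>{y \<in> ?Zd. ?m y = q}. z y) * nf M g x"
        unfolding sum_distrib_right by (intro sum.cong) (auto simp: Mg)
      also have "(\<Sum>y\<in>{y \<in> ?Zd. ?m y = q}. z y) = (\<Sum>y\<in>(\<lambda>w. (w, g)) ` {w. mset w = M}. z y)"
        using M by (intro sum.mono_neutral_left) (auto simp: Mg supp_def finite_mset_eq)
      also have "\<dots> = symb z M g"
        unfolding symb_def by (subst sum.reindex) (auto simp: inj_on_def)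
      finally show "(\<Sum>y\<in>{y \<in> ?Zd. ?m y = q}. z y * nf (mset (fst y)) (snd y) x)
        = (case q of (M, g) \<Rightarrow> symb z M g * nf M g x)" by (simp add: Mg)
    qed
    finally show ?thesis .
  qed
  have "(\<lambda>x. \<Sum>y\<in>?Z. smul (z y) (sub (basis (fst y) (snd y)) (b y)) x) \<in> Q d"
    using fin diff by (intro Q_sum Q_smul)
  moreover have "(\<lambda>x. \<Sum>y\<in>?Z. smul (z y) (sub (basis (fst y) (snd y)) (b y)) x)
      = sub z (\<lambda>x. \<Sum>(M, g)\<in>topset d z. symb z M g * nf M g x)"
    unfolding sub_def 2[symmetric] by (subst (2) 1) (simp add: smul_def right_diff_distrib sum_subtractf)
  ultimately show ?thesis by simp
qed

section \<open>Top-degree coefficients read off from the operators\<close>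

definition deg :: "(nat \<Rightarrow> int) \<Rightarrow> int" where "deg a = (\<Sum>j=1..n. a j)"
definition cnt :: "nat list \<Rightarrow> nat \<Rightarrow> int" where "cnt w = (\<lambda>j. int (count (mset w) j))"

lemma deg_upd: "j \<in> {1..n} \<Longrightarrow> deg (a(j := c)) = deg a - a j + c"
proof -
  assume j: "j \<in> {1..n}"
  have "deg (a(j := c)) - deg a = (\<Sum>i=1..n. if i = j then c - a j else 0)"
    unfolding deg_def sum_subtractf[symmetric] by (intro sum.cong) auto
  also have "\<dots> = c - a j" using j by (simp add: sum.delta')
  finally show ?thesis by simp
qed

lemma deg_upd': "j \<in> {1..n} \<Longrightarrow> deg (\<lambda>i. if i = j then c else a i) = deg a - a j + c"
  using deg_upd[of j a c] by (simp add: fun_upd_def)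

lemma deg_cnt: "set w \<subseteq> {1..n} \<Longrightarrow> deg (cnt w) = int (length w)"
proof (induction w)
  case (Cons x w)
  have "cnt (x # w) = (cnt w)(x := cnt w x + 1)" by (auto simp: cnt_def)
  with Cons show ?case by (simp add: deg_upd deg_upd')
qed (simp add: deg_def cnt_def)

text \<open>The part \<open>W\<close> of each \<open>X j\<close> lowers the degree, so only the \<open>Y\<close> contribute in top degree.\<close>

lemma app_Xs:
  assumes F: "\<And>a h. deg a < D \<Longrightarrow> F (a, h) = 0"
  shows "set w \<subseteq> {1..n} \<Longrightarrow> deg b + int (length w) \<le> D \<Longrightarrow>
    app (prod_list (map X w)) F (b, h) = chi \<zeta> h w * F (\<lambda>j. b j + cnt w j, h)"
proof (induction w arbitrary: b h)
  case Nil
  then show ?case by (simp add: cnt_def)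
next
  case (Cons i w)
  let ?P = "app (prod_list (map X w)) F"
  have i: "i \<in> {1..n}" and k: "pr i \<in> {1..n}" using Cons.prems pr_in by auto
  have "?P (b(i := b i + 1), h) = chi \<zeta> h w * F (\<lambda>j. (b(i := b i + 1)) j + cnt w j, h)"
    using Cons.prems i by (intro Cons.IH) (auto simp: deg_upd deg_upd')
  also have "(\<lambda>j. (b(i := b i + 1)) j + cnt w j) = (\<lambda>j. b j + cnt (i # w) j)"
    by (auto simp: cnt_def)
  finally have 1: "?P (b(i := b i + 1), h) = chi \<zeta> h w * F (\<lambda>j. b j + cnt (i # w) j, h)" .
  \<comment> \<open>\<open>W (pr i)\<close> lowers the degree by one, and the remaining word raises
    it only by its length, so F is evaluated below degree D.\<close>
  have 2: "?P (b(pr i := b (pr i) - 1), h') = 0" for h'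
  proof -
    let ?b = "b(pr i := b (pr i) - 1)"
    have "?P (?b, h') = chi \<zeta> h' w * F (\<lambda>j. ?b j + cnt w j, h')"
      using Cons.prems k by (intro Cons.IH) (auto simp: deg_upd deg_upd')
    moreover have "deg (\<lambda>j. ?b j + cnt w j) < D"
    proof -
      have "deg (\<lambda>j. ?b j + cnt w j) = deg ?b + deg (cnt w)" by (simp add: deg_def sum.distrib)
      then show ?thesis using Cons.prems k by (simp add: deg_upd deg_upd' deg_cnt)
    qed
    ultimately show ?thesis using F by simp
  qed
  show ?case by (simp add: X_def[of i] W_def[of "pr i"] 1 2 chi_Cons)
qed

definition \<delta> :: "pt \<Rightarrow> pt \<Rightarrow> complex" where "\<delta> p q = (if q = p then 1 else 0)"

text \<open>Applied to a delta function and evaluated at the monomial 1, \<open>\<phi> z\<close>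
  yields the coefficient of y^M g in the image of z; shorter words cannot reach degree d. So
  \<open>symb\<close> depends on \<open>\<phi> z\<close> alone, which is the linear independence of
  the monomials x^M g.\<close>

lemma symb_app:
  assumes z: "z \<in> Algd (Suc d)" and M: "size M = d" "set_mset M \<subseteq> {1..n}" and g: "g \<in> Gset n l"
  shows "symb z M g = app (\<phi> z) (\<delta> (\<lambda>j. int (count M j), g)) (\<lambda>_. 0, gunit)"
proof -
  let ?D = "\<delta> (\<lambda>j. int (count M j), g)"
  have za: "z \<in> Alg n l" using z by (rule Algd_Alg)
  obtain v where v: "mset v = M" by (metis ex_mset)
  have degM: "deg (\<lambda>j. int (count M j)) = int d"
    using deg_cnt[of v] v M by (auto simp: cnt_def)
  have E: "app (E (w, h)) ?D (\<lambda>_. 0, gunit) = (if mset w = M \<and> h = g then 1 else 0)"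
    if wh: "(w, h) \<in> supp z" for w h
  proof -
    have wp: "set w \<subseteq> {1..n}" "h \<in> Gset n l" "length w \<le> d"
      using suppD[OF za wh] supp_lengthD[OF z wh] by simp_all
    have "app (E (w, h)) ?D (\<lambda>_. 0, gunit) = app (prod_list (map X w)) (app (G h) ?D) (\<lambda>_. 0, gunit)"
      by (simp add: E_def)
    also have "\<dots> = chi \<zeta> gunit w * app (G h) ?D (\<lambda>j. 0 + cnt w j, gunit)"
    proof (rule app_Xs[where D = "int d"])
      show "app (G h) ?D (a, k) = 0" if "deg a < int d" for a k
        using that degM by (auto simp: \<delta>_def)
      show "deg (\<lambda>_. 0) + int (length w) \<le> int d" using wp by (simp add: deg_def)
    qed (rule wp)
    also have "\<dots> = (if mset w = M \<and> h = g then 1 else 0)"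
      using wp by (auto simp: \<delta>_def cnt_def multiset_eq_iff fun_eq_iff)
    finally show ?thesis .
  qed
  have "app (\<phi> z) ?D (\<lambda>_. 0, gunit) = (\<Sum>y\<in>supp z. z y * (if mset (fst y) = M \<and> snd y = g then 1 else 0))"
    unfolding \<phi>_def app_sum using E by (intro sum.cong refl) (simp add: split_paired_all)
  also have "\<dots> = (\<Sum>y\<in>(\<lambda>w. (w, g)) ` {w. mset w = M}. z y)"
    using finite_mset_eq za by (intro sum.mono_neutral_cong) (auto simp: supp_def Alg_def)
  also have "\<dots> = symb z M g"
    unfolding symb_def by (subst sum.reindex) (auto simp: inj_on_def)
  finally show ?thesis by simp
qed

text \<open>If the image vanishes, so do all top coefficients, and \<open>reduce_Q\<close> lowers
  the degree modulo the ideal. With \<open>phi_Ideal\<close> this identifies H with the image of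
  \<open>Alg n l\<close>.\<close>

lemma kernel_phi: "z \<in> Algd d \<Longrightarrow> \<phi> z = 0 \<Longrightarrow> z \<in> Ideal n l \<zeta> t"
proof (induction d arbitrary: z)
  case 0
  then have "z = (\<lambda>_. 0)" by (auto simp: Algd_def Sp_def supp_def)
  then show ?case by (simp add: Ideal.zero)
next
  case (Suc d)
  have za: "z \<in> Alg n l" using Suc.prems(1) by (rule Algd_Alg)
  have "symb z M g = 0" if "(M, g) \<in> topset d z" for M g
    using symb_app[OF Suc.prems(1)] topset_D[OF za that] Suc.prems(2) by simp
  then have "(\<lambda>x. \<Sum>(M, g)\<in>topset d z. symb z M g * nf M g x) = (\<lambda>_. 0)"
    by (intro ext sum.neutral) auto
  with reduce_Q[OF Suc.prems(1)] have "z \<in> Q d" by (simp add: sub_def)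
  then obtain i r where *: "i \<in> Ideal n l \<zeta> t" "r \<in> Algd d" "z = add i r" by (auto simp: Q_def)
  then have "\<phi> z = \<phi> i + \<phi> r" by (simp add: phi_add fin_supp_Alg Ideal_Alg Algd_Alg)
  then have "\<phi> r = 0" using phi_Ideal[OF *(1)] Suc.prems(2) by simp
  then show ?case using Suc.IH[OF *(2)] * Ideal.add by blast
qed

lemma Ideal_iff: "z \<in> Alg n l \<Longrightarrow> z \<in> Ideal n l \<zeta> t \<longleftrightarrow> \<phi> z = 0"
  using Alg_Algd kernel_phi phi_Ideal by metis

section \<open>Central elements\<close>

lemma geom_zero: "q ^ l = 1 \<Longrightarrow> q \<noteq> 1 \<Longrightarrow> (\<Sum>m<l. q ^ m) = (0::complex)"
  by (simp add: sum_gp_strict)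

text \<open>For neighbours, \<open>q_power_commute\<close> applies with q = zeta if j follows i, and
  with q = 1/zeta if i follows j; both are l-th roots of unity other than 1.\<close>

lemma X_pow_l_comm:
  assumes i: "i \<in> {1..n}" and j: "j \<in> {1..n}"
  shows "X j * X i ^ l = X i ^ l * X j"
proof -
  have *: ?thesis if "X j * X i = X i * X j + c \<star> G (ge k)" "k \<in> {1..n}" "\<zeta> ^ ge k i \<noteq> 1" for c k
  proof -
    have "(\<zeta> ^ ge k i) ^ l = 1" using root by (metis power_mult mult.commute power_one)
    then show ?thesis
      using q_power_commute[OF that(1) G_X[OF Gset_ge[OF that(2)] i], of l] geom_zero[OF _ that(3)] by simp
  qed
  have "inverse \<zeta> \<noteq> 1" using zeta_neq_1 by simp
  consider "j = nx i" | "i = nx j" | "j \<noteq> nx i" "i \<noteq> nx j" by blast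
  then show ?thesis
  proof cases
    case 1
    show ?thesis
    proof (rule *)
      show "X j * X i = X i * X j + (- t i) \<star> G (ge i)"
        using X_nx[OF i] unfolding 1 by (simp add: sc_minus_left algebra_simps)
    qed (use i zeta_neq_1 in \<open>simp_all add: ge_val\<close>)
  next
    case 2
    show ?thesis
    proof (rule *)
      show "X j * X i = X i * X j + t j \<star> G (ge j)"
        using X_nx[OF j] unfolding 2 by (simp add: algebra_simps)
    qed (use j in \<open>simp_all add: 2 ge_val(2)[unfolded One_nat_def] zpow_pred[unfolded One_nat_def] zeta_neq_1\<close>)
  next
    case 3
    then show ?thesis using X_comm[OF i j] by (metis power_commuting_commutes)
  qed
qed

lemma G_X_pow_l:
  assumes "h \<in> Gset n l" "i \<in> {1..n}"
  shows "G h * X i ^ l = X i ^ l * G h"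
proof -
  have "(\<Prod>j\<leftarrow>replicate l i. \<zeta> ^ h j) = 1"
    using root by (simp add: prod_list_replicate) (metis power_mult mult.commute power_one)
  then show ?thesis
    using prod_list_qcommute[of "replicate l i" "G h" X "\<lambda>j. \<zeta> ^ h j"] assms
    by (simp add: G_X prod_list_replicate)
qed

text \<open>Commuting with these generators already implies commuting with the image of all of
  \<open>Alg n l\<close>, by \<open>central_op_phi\<close>.\<close>

definition central_op :: "pt lop \<Rightarrow> bool" where
  "central_op T \<longleftrightarrow> (\<forall>j\<in>{1..n}. T * X j = X j * T) \<and> (\<forall>h\<in>Gset n l. T * G h = G h * T)"

lemma central_op_X_pow: "i \<in> {1..n} \<Longrightarrow> central_op (X i ^ l)"
  by (simp add: central_op_def X_pow_l_comm G_X_pow_l)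

lemma central_op_E:
  assumes T: "central_op T" and "set w \<subseteq> {1..n}" "g \<in> Gset n l"
  shows "T * E (w, g) = E (w, g) * T"
proof -
  have "T * prod_list (map X w) = prod_list (map (\<lambda>_. 1) w) \<star> (prod_list (map X w) * T)"
    using assms by (intro prod_list_qcommute) (auto simp: central_op_def)
  also have "prod_list (map (\<lambda>_. 1) w) = (1::complex)" by (induction w) auto
  finally have "T * prod_list (map X w) = prod_list (map X w) * T" by simp
  moreover have "T * G g = G g * T" using assms by (simp add: central_op_def)
  ultimately show ?thesis unfolding E_def fst_conv snd_conv by (rule commute_mult)
qed

lemma central_op_phi:
  assumes "central_op T" "f \<in> Alg n l"
  shows "T * \<phi> f = \<phi> f * T"
  unfolding \<phi>_def sum_distrib_left sum_distrib_right
  using assms suppD[OF assms(2)] by (intro sum.cong refl) (auto simp: central_op_E)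

section \<open>The noncommutative continuant behind w\<close>

definition V :: "nat \<Rightarrow> pt lop" where "V j = W (pr j)"
definition Us where "Us a k = prod_list (map Y [a..<a+k])"
definition Vs where "Vs a k = prod_list (map V [a..<a+k])"

lemma Us_Suc: "Us a (Suc k) = Us a k * Y (a + k)"
  and Vs_Suc: "Vs a (Suc k) = Vs a k * V (a + k)"
  by (simp_all add: Us_def Vs_def)

lemma Vs_Cons: "Vs a (Suc k) = V a * Vs (Suc a) k"
proof -
  have "[a..<a + Suc k] = a # [Suc a..<Suc a + k]" by (simp add: upt_conv_Cons del: upt_Suc)
  then show ?thesis unfolding Vs_def by (simp only: list.map prod_list.Cons)
qed

text \<open>The sum over matchings of the path \<open>a, ..., a+k-1\<close>, where an edge \<open>{i, i+1}\<close> replaces \<open>x_i x_(i+1)\<close> by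
  \<open>tau_i g_i\<close>.\<close>

fun K :: "nat \<Rightarrow> nat \<Rightarrow> pt lop" where
  "K a 0 = 1"
| "K a (Suc 0) = X a"
| "K a (Suc (Suc k)) = K a (Suc k) * X (a + k + 1) + tau n \<zeta> t (a + k) \<star> (K a k * G (ge (a + k)))"

text \<open>On a path, a word without a factor u_j v_(j+1) has the form v...v u...u, so it ends in u
  or consists of v alone. In the induction, \<open>K a (Suc k) * V (Suc (a + k))\<close> contains a
  product u v that equals -tau g and cancels the matching term in the recursion of
  \<open>K\<close>.\<close>

lemma K_right: "1 \<le> a \<Longrightarrow> a + k \<le> n \<Longrightarrow> K a (Suc k) = K a k * Y (a + k) + Vs a (Suc k)"
proof (induction k)
  case 0
  then show ?case by (simp add: X_def Vs_def V_def)
next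
  case (Suc k)
  have YV: "Y (a + k) * V (Suc (a + k)) = - (tau n \<zeta> t (a + k) \<star> G (ge (a + k)))"
    using Suc.prems Y_W[of "a + k"] by (simp add: V_def pr_def tau_def sc_minus_left)
  have "K a (Suc k) = K a k * Y (a + k) + Vs a (Suc k)" using Suc by simp
  then have "K a (Suc k) * V (Suc (a + k)) = K a k * (Y (a + k) * V (Suc (a + k))) + Vs a (Suc k) * V (Suc (a + k))"
    by (simp add: distrib_right mult.assoc)
  then show ?case
    by (simp add: YV X_def distrib_left Vs_Suc[of a "Suc k"] flip: V_def)
qed

text \<open>The same words split at the first letter: they begin with v_1 or consist of u
  alone.\<close>

lemma K_left: "Suc k \<le> n \<Longrightarrow> K 1 (Suc k) = V 1 * K 2 k + Us 1 (Suc k)"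
proof (induction k)
  case 0
  then show ?case by (simp add: X_def Us_def V_def)
next
  case (Suc k)
  have 2: "K 2 (Suc k) = K 2 k * Y (2 + k) + Vs 2 (Suc k)"
    using Suc.prems by (intro K_right) auto
  have "K 1 (Suc (Suc k)) = K 1 (Suc k) * Y (1 + Suc k) + Vs 1 (Suc (Suc k))"
    using Suc.prems by (intro K_right) auto
  also have "\<dots> = V 1 * K 2 (Suc k) + Us 1 (Suc (Suc k))"
    unfolding 2 using Suc
    by (simp add: Vs_Cons[of "Suc 0" "Suc k"] Us_Suc[of "Suc 0" "Suc k"] algebra_simps numeral_2_eq_2)
  finally show ?case .
qed

text \<open>v_1 is a multiple of y_n^(-1) g_n. It commutes with x_j for 1 < j < n, because g_n fixes
  u_j and the v commute, and with the g_j that occur, because they fix x_1.\<close>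

lemma V1_K: "2 + k \<le> n \<Longrightarrow> V 1 * K 2 k = K 2 k * V 1"
proof (induction k rule: less_induct)
  case (less k)
  have Vn: "V 1 = W n" by (simp add: V_def pr_def)
  have nn: "n \<in> {1..n}" using n3 by simp
  have VX: "V 1 * X j = X j * V 1" if "2 \<le> j" "j < n" for j
  proof -
    have "ge n j = 0" using that by (auto simp: gen_def nxt_def)
    moreover have "j \<in> {1..n}" using that by simp
    ultimately show ?thesis
      using W_Y[of j n] W_W[OF nn pr_in[of j]] by (simp add: Vn[unfolded One_nat_def] X_def distrib_left distrib_right)
  qed
  have VG: "V 1 * G (ge j) = G (ge j) * V 1" if "2 \<le> j" "j < n" for j
  proof -
    have "ge j (nx n) = 0" using that n3 by (auto simp: gen_def nxt_def)
    then show ?thesis using G_W[OF Gset_ge nn, of j] that by (simp add: Vn[unfolded One_nat_def])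
  qed
  show ?case
  proof (cases "k \<le> 1")
    case False
    then obtain m where m: "k = Suc (Suc m)" by (auto simp: not_le less_iff_Suc_add)
    have "V 1 * (K 2 (Suc m) * X (2 + m + 1)) = K 2 (Suc m) * X (2 + m + 1) * V 1"
      using less.prems m by (intro commute_mult less.IH VX) auto
    moreover have "V 1 * (K 2 m * G (ge (2 + m))) = K 2 m * G (ge (2 + m)) * V 1"
      using less.prems m by (intro commute_mult less.IH VG) auto
    ultimately show ?thesis by (simp add: m distrib_left distrib_right)
  next
    case True
    then have "k = 0 \<or> k = Suc 0" by auto
    then show ?thesis using less.prems VX[of 2] by auto
  qed
qed

text \<open>The words of the path 1, ..., n other than the two constant ones begin with v_1 and end
  with u_n; the matchings that use the edge {n, 1} cancel exactly these.\<close>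

lemma K_cyclic: "K 1 n + tau n \<zeta> t n \<star> (K 2 (n - 2) * G (ge n)) = Us 1 n + Vs 1 n"
proof -
  define m where "m = n - 2"
  have m: "Suc (Suc m) = n" using n3 by (simp add: m_def)
  have nn: "n \<in> {1..n}" using n3 by simp
  have "V 1 * K 2 m * Y n = K 2 m * (V 1 * Y n)"
    using V1_K[of m] m by (simp add: mult.assoc)
  \<comment> \<open>Here v_1 stands to the left of u_n, against the cyclic order u_n v_1; the
    reordering is the origin of the factor zeta in tau_n.\<close>
  also have "V 1 * Y n = \<zeta> \<star> (Y n * W n)"
    using W_Y[OF nn, of n] by (simp add: V_def pr_def ge_val)
  also have "\<dots> = - (tau n \<zeta> t n \<star> G (ge n))"
    by (simp add: Y_W tau_def flip: sc_minus_left)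
  finally have 1: "tau n \<zeta> t n \<star> (K 2 m * G (ge n)) = - (V 1 * K 2 m * Y n)" by simp
  have 2: "K 1 n = K 1 (Suc m) * Y n + Vs 1 n" using K_right[of 1 "Suc m"] m by simp
  have 3: "K 1 (Suc m) = V 1 * K 2 m + Us 1 (Suc m)" using K_left[of m] m by simp
  have 4: "Us 1 n = Us 1 (Suc m) * Y n" using Us_Suc[of 1 "Suc m"] m by simp
  show ?thesis unfolding m_def[symmetric] 1 2 3 4 by (simp add: distrib_right)
qed

lemma upt_set: "set [1..<1+n] = {1..n}" by auto

lemma prod_list_upt: "prod_list (map (f :: nat \<Rightarrow> 'b::comm_monoid_mult) [1..<1+n]) = (\<Prod>j=1..n. f j)"
  by (simp only: prod.distinct_set_conv_list[OF distinct_upt, symmetric] upt_set)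

lemma prod_zpow: "(\<Prod>j=1..n. \<zeta> ^ f j) = \<zeta> ^ (\<Sum>j=1..n. f j)"
  by (simp add: power_sum)

lemma Gset_zsum: "h \<in> Gset n l \<Longrightarrow> \<zeta> ^ psum h n = 1"
  unfolding zpow_eq_1 by (auto simp: Gset_def)

text \<open>Moving an element across u_1...u_n or v_1...v_n collects one scalar per factor, and
  these multiply to 1: for group elements because of determinant 1, and for u_i against v_1...v_n
  because g_i and g_(i-1) contribute inverse scalars.\<close>

lemma central_op_UV: "central_op (Us 1 n + Vs 1 n)"
proof -
  have q: "prod_list (map f [1..<1+n]) * T = T * prod_list (map f [1..<1+n])"
    if "\<And>j. j \<in> {1..n} \<Longrightarrow> T * f j = c j \<star> (f j * T)" "(\<Prod>j=1..n. c j) = 1" for T :: "pt lop" and f c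
  proof -
    have "T * prod_list (map f [1..<1+n]) = prod_list (map c [1..<1+n]) \<star> (prod_list (map f [1..<1+n]) * T)"
      by (rule prod_list_qcommute) (simp only: upt_set that(1))
    then show ?thesis unfolding prod_list_upt that(2) by simp
  qed
  have UY: "Us 1 n * Y j = Y j * Us 1 n" for j
    unfolding Us_def by (rule q[of _ _ "\<lambda>_. 1"]) (simp_all add: Y_Y[of j])
  have UG: "Us 1 n * G h = G h * Us 1 n" if h: "h \<in> Gset n l" for h
    unfolding Us_def by (rule q[of _ _ "\<lambda>j. \<zeta> ^ h j"]) (use G_Y Gset_zsum[OF h] prod_zpow[of h] in simp_all)
  have UW: "Us 1 n * W k = W k * Us 1 n" if k: "k \<in> {1..n}" for k
    unfolding Us_def by (rule q[of _ _ "\<lambda>j. \<zeta> ^ ge k j"])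
      (use W_Y Gset_zsum[OF Gset_ge[OF k]] prod_zpow[of "ge k"] in simp_all)
  have VW: "Vs 1 n * W k = W k * Vs 1 n" if k: "k \<in> {1..n}" for k
    unfolding Vs_def by (rule q[of _ _ "\<lambda>_. 1"]) (use W_W[OF k pr_in] in \<open>simp_all add: V_def\<close>)
  have VG: "Vs 1 n * G h = G h * Vs 1 n" if h: "h \<in> Gset n l" for h
    unfolding Vs_def by (rule q[of _ _ "\<lambda>j. \<zeta> ^ h j"])
      (use G_W[OF h pr_in] nx_pr Gset_zsum[OF h] prod_zpow[of h] in \<open>simp_all add: V_def\<close>)
  have VY: "Vs 1 n * Y i = Y i * Vs 1 n" if i: "i \<in> {1..n}" for i
  proof -
    have "(\<Sum>j=1..n. ge (pr j) i) = (\<Sum>j=1..n. (if j = nx i then 1 else 0) + (if j = i then l - 1 else 0))"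
    proof (rule sum.cong[OF refl])
      fix j assume j: "j \<in> {1..n}"
      show "ge (pr j) i = (if j = nx i then 1 else 0) + (if j = i then l - 1 else 0)"
        using nx_pr[OF j] pr_nx[OF i] nx_neq[of i] by (auto simp: gen_def)
    qed
    also have "\<dots> = l" using i nx_in[OF i] l2 by (simp add: sum.distrib sum.delta')
    finally have s: "(\<Sum>j=1..n. ge (pr j) i) = l" .
    show ?thesis unfolding Vs_def
    proof (rule q[of _ _ "\<lambda>j. inverse (\<zeta> ^ ge (pr j) i)"])
      show "Y i * V j = inverse (\<zeta> ^ ge (pr j) i) \<star> (V j * Y i)" for j
        using W_Y[OF i, of "pr j"] by (simp add: V_def)
      have "(\<Prod>j=1..n. inverse (\<zeta> ^ ge (pr j) i)) = inverse (\<Prod>j=1..n. \<zeta> ^ ge (pr j) i)"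
        by (simp add: prod_inversef[symmetric] comp_def)
      then show "(\<Prod>j=1..n. inverse (\<zeta> ^ ge (pr j) i)) = 1"
        unfolding prod_zpow s root by simp
    qed
  qed
  show ?thesis unfolding central_op_def
    using UY UG UW VW VG VY pr_in by (auto simp: X_def distrib_left distrib_right)
qed

section \<open>The image of w under \<open>\<phi>\<close>\<close>

lemma mpow_xv: "mpow n l \<zeta> (xv j) k = basis (replicate k j) gunit"
  by (induction k) (simp_all add: one_def xv_def mult_basis)

lemma xpow_basis:
  "xpow n l \<zeta> p = basis (concat (map (\<lambda>j. replicate (p j) j) [1..<n+1])) gunit"
proof -
  have "foldr (\<lambda>j acc. mpow n l \<zeta> (xv j) (p j) \<odot> acc) js one
      = basis (concat (map (\<lambda>j. replicate (p j) j) js)) gunit" for js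
    by (induction js) (simp_all add: one_def mpow_xv mult_basis)
  then show ?thesis unfolding xpow_def .
qed

lemma phi_xpow: "\<phi> (xpow n l \<zeta> p) = prod_list (map (\<lambda>j. X j ^ p j) [1..<n+1])"
proof -
  have "prod_list (map X (concat (map (\<lambda>j. replicate (p j) j) js))) = prod_list (map (\<lambda>j. X j ^ p j) js)" for js
    by (induction js) (simp_all add: prod_list_replicate)
  then show ?thesis by (simp add: xpow_basis E_def del: upt_Suc)
qed

lemma xpow_Algd: "(\<Sum>j=1..n. p j) < d \<Longrightarrow> xpow n l \<zeta> p \<in> Algd d"
proof -
  have "(\<Sum>j\<leftarrow>[1..<n+1]. p j) = (\<Sum>j=1..n. p j)"
    by (simp only: sum.distinct_set_conv_list[OF distinct_upt, symmetric]) (rule sum.cong, auto)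
  then have "length (concat (map (\<lambda>j. replicate (p j) j) [1..<n+1])) = (\<Sum>j=1..n. p j)"
    by (simp add: length_concat comp_def del: upt_Suc)
  then show "(\<Sum>j=1..n. p j) < d \<Longrightarrow> xpow n l \<zeta> p \<in> Algd d"
    unfolding xpow_basis by (intro Algd_basis) (auto simp del: upt_Suc)
qed

lemma gprod_Algd: "set js \<subseteq> {1..n} \<Longrightarrow> gprod n l \<zeta> js \<in> Algd 1"
  and phi_gprod: "set js \<subseteq> {1..n} \<Longrightarrow> \<phi> (gprod n l \<zeta> js) = prod_list (map (\<lambda>i. G (ge i)) js)"
proof (induction js)
  case Nil
  { case 1 show ?case by (simp add: gprod_def one_def Algd_basis) }
  { case 2 show ?case by (simp add: gprod_def) }
next
  case (Cons i js)
  have g: "gprod n l \<zeta> (i # js) = gv n l i \<odot> gprod n l \<zeta> js" by (simp add: gprod_def)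
  {
    case 1
    then have "gv n l i \<in> Algd 1" unfolding gv_def by (intro Algd_basis) auto
    from Algd_mult[OF this] Cons.IH(1) 1 show ?case by (simp add: g)
  next
    case 2
    with Cons.IH show ?case by (simp add: g phi_mult Algd_Alg)
  }
qed

text \<open>\<open>Ind a b\<close>, \<open>pexp\<close> and \<open>P a b\<close> are the analogues of \<open>Jset\<close>, \<open>expo\<close> and the terms of \<open>w\<close> for the path with
  vertices \<open>a, ..., b-1\<close> in place of the cycle; the edge \<open>{r, r+1}\<close> is named \<open>r\<close>.\<close>

definition pexp :: "nat set \<Rightarrow> nat \<Rightarrow> nat" where
  "pexp S j = (if j \<in> S \<or> (\<exists>r\<in>S. Suc r = j) then 0 else 1)"

definition P :: "nat \<Rightarrow> nat \<Rightarrow> nat set \<Rightarrow> pt lop" where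
  "P a b S = prod_list (map (\<lambda>j. X j ^ pexp S j) [a..<b]) *
     prod_list (map (\<lambda>i. G (ge i)) (sorted_list_of_set S))"

definition Ind :: "nat \<Rightarrow> nat \<Rightarrow> nat set set" where
  "Ind a b = {S. S \<subseteq> {a..<b-1} \<and> (\<forall>r\<in>S. Suc r \<notin> S)}"

abbreviation \<tau> where "\<tau> \<equiv> tau n \<zeta> t"

lemma finite_Ind: "finite (Ind a b)"
  by (rule finite_subset[of _ "Pow {a..<b-1}"]) (auto simp: Ind_def)

lemma Ind_finite: "S \<in> Ind a b \<Longrightarrow> finite S"
  unfolding Ind_def using finite_subset[OF _ finite_atLeastLessThan] by blast

lemma sorted_list_insert_max:
  assumes "finite S" "\<And>r. r \<in> S \<Longrightarrow> r < (m::nat)"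
  shows "sorted_list_of_set (insert m S) = sorted_list_of_set S @ [m]"
proof (rule sorted_distinct_set_unique)
  show "sorted (sorted_list_of_set S @ [m])" "distinct (sorted_list_of_set S @ [m])"
    using assms by (auto simp: sorted_append dest: less_imp_le)
  show "set (sorted_list_of_set (insert m S)) = set (sorted_list_of_set S @ [m])"
    using assms by (simp del: sorted_list_of_set_insert_remove)
qed simp_all

lemma IndD: "S \<in> Ind a b \<Longrightarrow> r \<in> S \<Longrightarrow> a \<le> r \<and> r < b - 1 \<and> Suc r \<notin> S"
  unfolding Ind_def by (metis (no_types, lifting) CollectD atLeastLessThan_iff subsetD)

lemma IndI: "(\<And>r. r \<in> S \<Longrightarrow> a \<le> r \<and> r < b - 1 \<and> Suc r \<notin> S) \<Longrightarrow> S \<in> Ind a b"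
  unfolding Ind_def by auto

text \<open>The split is by whether the last edge \<open>a + k\<close> is used; if it is, the edge
  before it is excluded.\<close>

lemma Ind_rec: "Ind a (a + k + 2) = Ind a (a + k + 1) \<union> insert (a + k) ` Ind a (a + k)"
proof (intro equalityI subsetI)
  fix S assume S: "S \<in> Ind a (a + k + 2)"
  show "S \<in> Ind a (a + k + 1) \<union> insert (a + k) ` Ind a (a + k)"
  proof (cases "a + k \<in> S")
    case False
    have "S \<in> Ind a (a + k + 1)"
    proof (rule IndI)
      fix r assume "r \<in> S"
      with IndD[OF S this] False show "a \<le> r \<and> r < a + k + 1 - 1 \<and> Suc r \<notin> S"
        by (cases "r = a + k") auto
    qed
    then show ?thesis by blast
  next
    case True
    have "S - {a + k} \<in> Ind a (a + k)"
    proof (rule IndI)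
      fix r assume r: "r \<in> S - {a + k}"
      then have "Suc r \<noteq> a + k" using IndD[OF S, of r] True by auto
      with r IndD[OF S, of r] show "a \<le> r \<and> r < a + k - 1 \<and> Suc r \<notin> S - {a + k}" by auto
    qed
    moreover have "S = insert (a + k) (S - {a + k})" using True by auto
    ultimately show ?thesis by blast
  qed
next
  fix S assume "S \<in> Ind a (a + k + 1) \<union> insert (a + k) ` Ind a (a + k)"
  then show "S \<in> Ind a (a + k + 2)"
  proof
    assume S: "S \<in> Ind a (a + k + 1)"
    show ?thesis by (rule IndI) (use IndD[OF S] in force)
  next
    assume "S \<in> insert (a + k) ` Ind a (a + k)"
    then obtain S' where S': "S' \<in> Ind a (a + k)" "S = insert (a + k) S'" by blast
    show ?thesis by (rule IndI) (use IndD[OF S'(1)] in \<open>force simp: S'(2)\<close>)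
  qed
qed

text \<open>The letter \<open>X (a + k + 1)\<close> has to pass the group elements to its right. It
  commutes with them because no edge in \<open>S\<close> reaches the vertex a + k + 1.\<close>

lemma P_skip:
  assumes a: "1 \<le> a" "a + k + 1 \<le> n" and S: "S \<in> Ind a (a + k + 1)"
  shows "P a (a + k + 2) S = P a (a + k + 1) S * X (a + k + 1)"
proof -
  have r: "a \<le> r \<and> r < a + k" if "r \<in> S" for r using IndD[OF S that] by auto
  have e: "pexp S (a + k + 1) = 1" using r by (force simp: pexp_def)
  let ?x = "prod_list (map (\<lambda>j. X j ^ pexp S j) [a..<a + k + 1])"
  let ?g = "prod_list (map (\<lambda>i. G (ge i)) (sorted_list_of_set S))"
  have "X (a + k + 1) * G (ge i) = G (ge i) * X (a + k + 1)" if "i \<in> S" for i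
  proof -
    have "ge i (a + k + 1) = 0" using r[OF that] a by (auto simp: gen_def nxt_def)
    then show ?thesis using G_X[OF Gset_ge, of i "a + k + 1"] r[OF that] a by simp
  qed
  then have "X (a + k + 1) * ?g = prod_list (map (\<lambda>_. 1) (sorted_list_of_set S)) \<star> (?g * X (a + k + 1))"
    using Ind_finite[OF S] by (intro prod_list_qcommute) simp
  also have "prod_list (map (\<lambda>_. 1::complex) xs) = 1" for xs :: "nat list" by (induction xs) auto
  finally have "?g * X (a + k + 1) = X (a + k + 1) * ?g" by simp
  moreover have "[a..<a + k + 2] = [a..<a + k + 1] @ [a + k + 1]" by simp
  ultimately show ?thesis unfolding P_def by (simp add: e[simplified] mult.assoc del: upt_Suc)
qed

lemma pexp_insert_max: "pexp (insert m S) j = (if j = m \<or> j = Suc m then 0 else pexp S j)"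
  by (auto simp: pexp_def)

text \<open>The edge a + k deletes the last two letters, and its group element comes last because a
  + k exceeds all members of \<open>S\<close>.\<close>

lemma P_take:
  assumes S: "S \<in> Ind a (a + k)"
  shows "P a (a + k + 2) (insert (a + k) S) = P a (a + k) S * G (ge (a + k))"
proof -
  have r: "r < a + k" if "r \<in> S" for r using IndD[OF S that] by auto
  have l: "[a..<a + k + 2] = [a..<a + k] @ [a + k, Suc (a + k)]" by simp
  have m: "map (\<lambda>j. X j ^ pexp (insert (a + k) S) j) [a..<a + k] = map (\<lambda>j. X j ^ pexp S j) [a..<a + k]"
    by (auto simp: pexp_insert_max)
  show ?thesis unfolding P_def l map_append m
    using sorted_list_insert_max[OF Ind_finite[OF S] r] by (simp add: pexp_insert_max mult.assoc)
qed

text \<open>\<open>Ind_rec\<close> together with \<open>P_skip\<close> and \<open>P_take\<close>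
  reproduces the recursion of \<open>K\<close>.\<close>

lemma sum_Ind_eq_K:
  "1 \<le> a \<Longrightarrow> a + k \<le> n + 1 \<Longrightarrow> (\<Sum>S\<in>Ind a (a + k). (\<Prod>i\<in>S. \<tau> i) \<star> P a (a + k) S) = K a k"
proof (induction a k rule: K.induct)
  case (1 a)
  have "Ind a (a + 0) = {{}}" by (auto simp: Ind_def)
  then show ?case by (simp add: P_def)
next
  case (2 a)
  have "Ind a (a + Suc 0) = {{}}" by (auto simp: Ind_def)
  then show ?case by (simp add: P_def pexp_def)
next
  case (3 a k)
  have r: "r < a + k" if "S \<in> Ind a (a + k) \<union> Ind a (a + k + 1)" "r \<in> S" for r S
    using that by (auto dest: IndD)
  have disj: "Ind a (a + k + 1) \<inter> insert (a + k) ` Ind a (a + k) = {}"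
    using r[of _ "a + k"] by blast
  have inj: "inj_on (insert (a + k)) (Ind a (a + k))"
  proof (rule inj_onI)
    fix S T assume "S \<in> Ind a (a + k)" "T \<in> Ind a (a + k)" "insert (a + k) S = insert (a + k) T"
    moreover from this have "a + k \<notin> S" "a + k \<notin> T" using r by blast+
    ultimately show "S = T" by (simp add: insert_ident)
  qed
  have ak: "a + Suc (Suc k) = a + k + 2" by simp
  have "(\<Sum>S\<in>Ind a (a + Suc (Suc k)). (\<Prod>i\<in>S. \<tau> i) \<star> P a (a + Suc (Suc k)) S)
     = (\<Sum>S\<in>Ind a (a + k + 1). (\<Prod>i\<in>S. \<tau> i) \<star> P a (a + k + 2) S)
      + (\<Sum>S\<in>Ind a (a + k). (\<Prod>i\<in>insert (a + k) S. \<tau> i) \<star> P a (a + k + 2) (insert (a + k) S))"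
    unfolding ak Ind_rec sum.union_disjoint[OF finite_Ind finite_imageI[OF finite_Ind] disj] sum.reindex[OF inj] comp_def ..
  also have "(\<Sum>S\<in>Ind a (a + k + 1). (\<Prod>i\<in>S. \<tau> i) \<star> P a (a + k + 2) S)
      = (\<Sum>S\<in>Ind a (a + k + 1). (\<Prod>i\<in>S. \<tau> i) \<star> P a (a + k + 1) S) * X (a + k + 1)"
    unfolding sum_distrib_right using "3.prems" by (intro sum.cong refl) (simp add: P_skip del: add_2_eq_Suc')
  also have "(\<Sum>S\<in>Ind a (a + k). (\<Prod>i\<in>insert (a + k) S. \<tau> i) \<star> P a (a + k + 2) (insert (a + k) S))
      = \<tau> (a + k) \<star> ((\<Sum>S\<in>Ind a (a + k). (\<Prod>i\<in>S. \<tau> i) \<star> P a (a + k) S) * G (ge (a + k)))"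
    unfolding sum_distrib_right sc_sum
  proof (intro sum.cong refl)
    fix S assume S: "S \<in> Ind a (a + k)"
    have "a + k \<notin> S" using r S by blast
    then show "(\<Prod>i\<in>insert (a + k) S. \<tau> i) \<star> P a (a + k + 2) (insert (a + k) S)
      = \<tau> (a + k) \<star> ((\<Prod>i\<in>S. \<tau> i) \<star> P a (a + k) S * G (ge (a + k)))"
      using Ind_finite[OF S] unfolding P_take[OF S] by simp
  qed
  also have "(\<Sum>S\<in>Ind a (a + k). (\<Prod>i\<in>S. \<tau> i) \<star> P a (a + k) S) = K a k"
    using 3 by simp
  also have "(\<Sum>S\<in>Ind a (a + k + 1). (\<Prod>i\<in>S. \<tau> i) \<star> P a (a + k + 1) S) = K a (Suc k)"
    using 3 by simp
  finally show ?case by simp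
qed

text \<open>Whether the edge \<open>{n, 1}\<close> is used splits the matchings of the cycle into matchings of two paths.\<close>

lemma Jset_split: "Jset n = Ind 1 (n + 1) \<union> insert n ` Ind 2 n"
proof (intro equalityI subsetI)
  fix S assume S: "S \<in> Jset n"
  have S1: "S \<subseteq> {1..n}" and S2: "\<And>r s. r \<in> S \<Longrightarrow> s \<in> S \<Longrightarrow> \<bar>int r - int s\<bar> \<notin> {1, int n - 1}"
    using S by (simp_all add: Jset_def)
  have suc: "Suc r \<notin> S" if "r \<in> S" for r using S2[OF that, of "Suc r"] by auto
  show "S \<in> Ind 1 (n + 1) \<union> insert n ` Ind 2 n"
  proof (cases "n \<in> S")
    case False
    have "S \<in> Ind 1 (n + 1)"
    proof (rule IndI)
      fix r assume "r \<in> S"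
      with S1 suc False show "1 \<le> r \<and> r < n + 1 - 1 \<and> Suc r \<notin> S" by (cases "r = n") auto
    qed
    then show ?thesis by blast
  next
    case True
    have "2 \<le> r \<and> r < n - 1" if r: "r \<in> S - {n}" for r
    proof -
      have "r \<noteq> 1" using S2[OF True, of r] r by auto
      moreover have "Suc r \<noteq> n" using suc[of r] r True by auto
      moreover have "1 \<le> r" "r \<le> n" "r \<noteq> n" using S1 r by auto
      ultimately show ?thesis by linarith
    qed
    then have "S - {n} \<in> Ind 2 n" using suc by (intro IndI) blast
    moreover have "S = insert n (S - {n})" using True by auto
    ultimately show ?thesis by blast
  qed
next
  fix S assume "S \<in> Ind 1 (n + 1) \<union> insert n ` Ind 2 n"
  then show "S \<in> Jset n"
  proof
    assume S: "S \<in> Ind 1 (n + 1)"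
    have "\<bar>int r - int s\<bar> \<notin> {1, int n - 1}" if rs: "r \<in> S" "s \<in> S" for r s
    proof -
      have "1 \<le> r" "r < n" "1 \<le> s" "s < n" "Suc r \<noteq> s" "Suc s \<noteq> r" using IndD[OF S rs(1)] IndD[OF S rs(2)] rs by auto
      then show ?thesis by auto
    qed
    moreover have "S \<subseteq> {1..n}" using IndD[OF S] by fastforce
    ultimately show ?thesis by (simp add: Jset_def)
  next
    assume "S \<in> insert n ` Ind 2 n"
    then obtain S' where S': "S' \<in> Ind 2 n" "S = insert n S'" by blast
    have b: "2 \<le> r \<and> r < n - 1" if "r \<in> S'" for r using IndD[OF S'(1) that] by auto
    have "\<bar>int r - int s\<bar> \<notin> {1, int n - 1}" if rs: "r \<in> S'" "s \<in> S'" for r s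
    proof -
      have "Suc r \<noteq> s" "Suc s \<noteq> r" using IndD[OF S'(1) rs(1)] IndD[OF S'(1) rs(2)] rs by auto
      then show ?thesis using b[OF rs(1)] b[OF rs(2)] by auto
    qed
    moreover have "\<bar>int n - int s\<bar> \<notin> {1, int n - 1}" "\<bar>int s - int n\<bar> \<notin> {1, int n - 1}" if "s \<in> S'" for s
      using b[OF that] by auto
    moreover have "\<bar>int n - int n\<bar> \<notin> {1, int n - 1}" using n3 by auto
    moreover have "S \<subseteq> {1..n}" using b S'(2) n3 by fastforce
    ultimately show ?thesis unfolding Jset_def S'(2) by blast
  qed
qed

lemma finite_Jset: "finite (Jset n)"
  by (simp add: Jset_split finite_Ind)

lemma Jset_sub: "S \<in> Jset n \<Longrightarrow> S \<subseteq> {1..n}" and Jset_fin: "S \<in> Jset n \<Longrightarrow> finite S"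
proof -
  show S: "S \<in> Jset n \<Longrightarrow> S \<subseteq> {1..n}" by (simp add: Jset_def)
  then show "S \<in> Jset n \<Longrightarrow> finite S" using finite_subset by blast
qed

lemma expo_eq: "finite S \<Longrightarrow> expo n S j = (if j \<in> S \<or> (\<exists>r\<in>S. j = nx r) then 0 else 1)"
proof -
  assume "finite S"
  then have "card {r \<in> S. j = r \<or> j = nx r} = 0 \<longleftrightarrow> \<not> (j \<in> S \<or> (\<exists>r\<in>S. j = nx r))" by auto
  then show ?thesis unfolding expo_def by auto
qed

definition wterm :: "nat set \<Rightarrow> elt" where
  "wterm S = xpow n l \<zeta> (expo n S) \<odot> gprod n l \<zeta> (sorted_list_of_set S)"

lemma wel_eq: "wel n l \<zeta> t = (\<lambda>x. \<Sum>S\<in>Jset n. smul (\<Prod>i\<in>S. \<tau> i) (wterm S) x)"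
  by (simp add: wel_def wterm_def smul_def)

lemma wterm_factors:
  assumes "S \<in> Jset n"
  shows "xpow n l \<zeta> (expo n S) \<in> Alg n l" "gprod n l \<zeta> (sorted_list_of_set S) \<in> Alg n l"
  using xpow_Algd[OF lessI] gprod_Algd[of "sorted_list_of_set S"] Jset_sub[OF assms] Jset_fin[OF assms]
  by (auto intro: Algd_Alg)

lemma wterm_Alg: "S \<in> Jset n \<Longrightarrow> wterm S \<in> Alg n l"
  unfolding wterm_def by (intro Alg_mult wterm_factors)

lemma phi_wterm:
  assumes "S \<in> Jset n"
  shows "\<phi> (wterm S) = prod_list (map (\<lambda>j. X j ^ expo n S j) [1..<n+1]) *
    prod_list (map (\<lambda>i. G (ge i)) (sorted_list_of_set S))"
  unfolding wterm_def phi_mult[OF wterm_factors[OF assms]] phi_xpow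
  using Jset_sub[OF assms] Jset_fin[OF assms] by (simp add: phi_gprod)

lemma phi_wterm_path:
  assumes "S \<in> Ind 1 (n + 1)"
  shows "\<phi> (wterm S) = P 1 (n + 1) S"
proof -
  have J: "S \<in> Jset n" using assms by (simp add: Jset_split)
  have "expo n S j = pexp S j" for j
    unfolding expo_eq[OF Jset_fin[OF J]] pexp_def using IndD[OF assms] by (fastforce simp: nxt_def)
  then show ?thesis unfolding phi_wterm[OF J] P_def by simp
qed

text \<open>The edge {n, 1} removes x_1 and x_n and leaves the path 2, ..., n - 1; as the largest
  index, n puts g_n at the right end.\<close>

lemma phi_wterm_cycle:
  assumes "S \<in> Ind 2 n"
  shows "\<phi> (wterm (insert n S)) = P 2 n S * G (ge n)"
proof -
  have J: "insert n S \<in> Jset n" using assms by (simp add: Jset_split)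
  have b: "2 \<le> r \<and> r < n - 1" if "r \<in> S" for r using IndD[OF assms that] by auto
  note e = expo_eq[OF Jset_fin[OF J]]
  have nxn: "nx n = 1" by (simp add: nxt_def)
  have l: "[1..<n+1] = 1 # [2..<n] @ [n]"
    using n3 by (simp add: upt_conv_Cons numeral_2_eq_2)
  have "expo n (insert n S) j = pexp S j" if "j \<in> set [2..<n]" for j
    unfolding e pexp_def using b that by (fastforce simp: nxt_def)
  then have m: "map (\<lambda>j. X j ^ expo n (insert n S) j) [2..<n] = map (\<lambda>j. X j ^ pexp S j) [2..<n]"
    by simp
  have z: "expo n (insert n S) 1 = 0" "expo n (insert n S) n = 0"
    unfolding e using nxn by auto
  have s: "sorted_list_of_set (insert n S) = sorted_list_of_set S @ [n]"
    using Ind_finite[OF assms] b by (intro sorted_list_insert_max) force+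
  show ?thesis unfolding phi_wterm[OF J] P_def l s list.map map_append m
    by (simp add: z[unfolded One_nat_def] mult.assoc)
qed

lemma wel_Alg: "wel n l \<zeta> t \<in> Alg n l"
  unfolding wel_eq using wterm_Alg by (intro Alg_sum finite_Jset Alg_smul)

text \<open>By \<open>Jset_split\<close> the two kinds of matchings sum to \<open>K 1 n\<close> and
  \<open>\<tau> n \<star> (K 2 (n - 2) * G (ge n))\<close>, and \<open>K_cyclic\<close> evaluates
  the total.\<close>

lemma phi_wel: "\<phi> (wel n l \<zeta> t) = Us 1 n + Vs 1 n"
proof -
  have n: "n \<notin> S" if "S \<in> Ind 1 (n + 1) \<union> Ind 2 n" for S using that by (auto dest: IndD)
  have disj: "Ind 1 (n + 1) \<inter> insert n ` Ind 2 n = {}" using n by blast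
  have inj: "inj_on (insert n) (Ind 2 n)"
  proof (rule inj_onI)
    fix S T assume "S \<in> Ind 2 n" "T \<in> Ind 2 n" "insert n S = insert n T"
    moreover from this have "n \<notin> S" "n \<notin> T" using n by blast+
    ultimately show "S = T" by (simp add: insert_ident)
  qed
  have "\<phi> (wel n l \<zeta> t) = (\<Sum>S\<in>Jset n. (\<Prod>i\<in>S. \<tau> i) \<star> \<phi> (wterm S))"
    unfolding wel_eq using wterm_Alg
    by (subst phi_sum[OF finite_Jset]) (auto simp: phi_smul fin_supp_Alg intro!: sum.cong)
  also have "\<dots> = (\<Sum>S\<in>Ind 1 (n + 1). (\<Prod>i\<in>S. \<tau> i) \<star> \<phi> (wterm S))
      + (\<Sum>S\<in>Ind 2 n. (\<Prod>i\<in>insert n S. \<tau> i) \<star> \<phi> (wterm (insert n S)))"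
    unfolding Jset_split sum.union_disjoint[OF finite_Ind finite_imageI[OF finite_Ind] disj] sum.reindex[OF inj]
    by simp
  also have "(\<Sum>S\<in>Ind 1 (n + 1). (\<Prod>i\<in>S. \<tau> i) \<star> \<phi> (wterm S))
      = (\<Sum>S\<in>Ind 1 (1 + n). (\<Prod>i\<in>S. \<tau> i) \<star> P 1 (1 + n) S)"
    by (intro sum.cong) (simp_all add: phi_wterm_path[simplified])
  also have "\<dots> = K 1 n" by (intro sum_Ind_eq_K) auto
  also have "(\<Sum>S\<in>Ind 2 n. (\<Prod>i\<in>insert n S. \<tau> i) \<star> \<phi> (wterm (insert n S)))
      = \<tau> n \<star> ((\<Sum>S\<in>Ind 2 (2 + (n - 2)). (\<Prod>i\<in>S. \<tau> i) \<star> P 2 (2 + (n - 2)) S) * G (ge n))"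
    unfolding sum_distrib_right sc_sum
  proof (intro sum.cong)
    have "2 + (n - 2) = n" using n3 by simp
    then show *: "Ind 2 n = Ind 2 (2 + (n - 2))" by (simp only:)
    fix S assume "S \<in> Ind 2 (2 + (n - 2))"
    then have S: "S \<in> Ind 2 n" using * by simp
    have "n \<notin> S" using n S by blast
    moreover have "2 + (n - 2) = n" using n3 by simp
    ultimately show "(\<Prod>i\<in>insert n S. \<tau> i) \<star> \<phi> (wterm (insert n S))
      = \<tau> n \<star> ((\<Prod>i\<in>S. \<tau> i) \<star> P 2 (2 + (n - 2)) S * G (ge n))"
      using Ind_finite[OF S] unfolding phi_wterm_cycle[OF S] by simp
  qed
  also have "(\<Sum>S\<in>Ind 2 (2 + (n - 2)). (\<Prod>i\<in>S. \<tau> i) \<star> P 2 (2 + (n - 2)) S) = K 2 (n - 2)"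
    using n3 by (intro sum_Ind_eq_K) auto
  finally show ?thesis unfolding K_cyclic .
qed

text \<open>Every edge removes letters from x_1...x_n, so only the empty set contributes in degree
  n.\<close>

lemma wel_lead: "sub (wel n l \<zeta> t) (basis [1..<n+1] gunit) \<in> Algd n"
proof -
  have e: "{} \<in> Jset n" by (simp add: Jset_def)
  have w0: "wterm {} = basis [1..<n+1] gunit"
  proof -
    have "concat (map (\<lambda>j. replicate (expo n {} j) j) js) = js" for js
      by (induction js) (simp_all add: expo_def)
    then show ?thesis unfolding wterm_def xpow_basis
      by (simp add: gprod_def one_def mult_basis del: upt_Suc)
  qed
  have short: "wterm S \<in> Algd n" if S: "S \<in> Jset n - {{}}" for S
  proof -
    have S': "S \<in> Jset n" "finite S" "S \<subseteq> {1..n}" using S Jset_fin Jset_sub by auto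
    obtain r where r: "r \<in> S" using S by blast
    have "(\<Sum>j=1..n. expo n S j) < (\<Sum>j=1..n. 1)"
    proof (rule sum_strict_mono_ex1)
      show "\<forall>j\<in>{1..n}. expo n S j \<le> 1" by (simp add: expo_def)
      show "\<exists>j\<in>{1..n}. expo n S j < 1" using r S' expo_eq[OF S'(2), of r] by (intro bexI[of _ r]) auto
    qed simp
    then have "xpow n l \<zeta> (expo n S) \<in> Algd n" by (intro xpow_Algd) simp
    from Algd_mult[OF this gprod_Algd[of "sorted_list_of_set S"]] S' show ?thesis by (simp add: wterm_def)
  qed
  have "sub (wel n l \<zeta> t) (basis [1..<n+1] gunit) = (\<lambda>x. \<Sum>S\<in>Jset n - {{}}. smul (\<Prod>i\<in>S. \<tau> i) (wterm S) x)"
    unfolding wel_eq sub_def sum.remove[OF finite_Jset e] w0 by (simp add: smul_def)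
  moreover have "\<dots> \<in> Algd n"
    unfolding Algd_def using short finite_Jset Algd_smul by (intro Sp_sum) (auto simp: Algd_def)
  ultimately show ?thesis by simp
qed

section \<open>Leading terms of central elements\<close>

definition gens :: "elt set" where
  "gens = insert (wel n l \<zeta> t) {mpow n l \<zeta> (xv i) l | i. i \<in> {1..n}}"

abbreviation Subalg where "Subalg \<equiv> Gen n l \<zeta> gens"

lemma central_op_add: "central_op S \<Longrightarrow> central_op T \<Longrightarrow> central_op (S + T)"
  and central_op_diff: "central_op S \<Longrightarrow> central_op T \<Longrightarrow> central_op (S - T)"
  and central_op_sc: "central_op T \<Longrightarrow> central_op (c \<star> T)"
  and central_op_one: "central_op 1"
  by (simp_all add: central_op_def algebra_simps)

lemma central_op_mult: "central_op S \<Longrightarrow> central_op T \<Longrightarrow> central_op (S * T)"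
  unfolding central_op_def using commute_mult by metis

lemma central_op_sum: "(\<And>i. i \<in> I \<Longrightarrow> central_op (f i)) \<Longrightarrow> central_op (sum f I)"
  by (induction I rule: infinite_finite_induct) (simp_all add: central_op_add, simp_all add: central_op_def)

lemma phi_mpow_xv: "\<phi> (mpow n l \<zeta> (xv i) k) = X i ^ k"
  by (simp add: mpow_xv E_def prod_list_replicate)

lemma Subalg_Alg_central: "y \<in> Subalg \<Longrightarrow> y \<in> Alg n l \<and> central_op (\<phi> y)"
proof (induction rule: Gen.induct)
  case (gen s)
  then consider "s = wel n l \<zeta> t" | i where "i \<in> {1..n}" "s = mpow n l \<zeta> (xv i) l"
    by (auto simp: gens_def)
  then show ?case
  proof cases
    case 1
    then show ?thesis by (simp only: wel_Alg phi_wel central_op_UV)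
  next
    case 2
    have "basis (replicate l i) gunit \<in> Alg n l" using 2(1) by (intro Alg_basis) auto
    with 2 show ?thesis by (simp add: phi_mpow_xv central_op_X_pow) (simp add: mpow_xv)
  qed
next
  case (scalar c)
  then show ?case by (simp add: Alg_smul phi_smul fin_supp_Alg central_op_sc central_op_one)
next
  case (add a b)
  then show ?case by (simp add: Alg_add phi_add fin_supp_Alg central_op_add)
next
  case (mult a b)
  then show ?case by (simp add: Alg_mult phi_mult central_op_mult)
qed

text \<open>Commutators lie in \<open>Alg n l\<close>, so \<open>Ideal_iff\<close> turns their
  membership in the ideal into equations between operators, which need testing on generators
  only.\<close>

lemma Center_iff: "z \<in> Center n l \<zeta> t \<longleftrightarrow> z \<in> Alg n l \<and> central_op (\<phi> z)"
proof -
  have comm: "sub (z \<odot> a) (a \<odot> z) \<in> Ideal n l \<zeta> t \<longleftrightarrow> \<phi> z * \<phi> a = \<phi> a * \<phi> z"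
    if "z \<in> Alg n l" "a \<in> Alg n l" for a
  proof -
    have "sub (z \<odot> a) (a \<odot> z) \<in> Alg n l" using that by blast
    then show ?thesis using that by (simp add: Ideal_iff phi_sub phi_mult fin_supp_Alg Alg_mult)
  qed
  show ?thesis
  proof
    assume z: "z \<in> Center n l \<zeta> t"
    then have za: "z \<in> Alg n l" by (simp add: Center_def)
    have c: "\<phi> z * \<phi> a = \<phi> a * \<phi> z" if "a \<in> Alg n l" for a
      using z comm[OF za that] that by (simp add: Center_def)
    have "\<phi> z * G h = G h * \<phi> z" if "h \<in> Gset n l" for h
      using c[OF Alg_basis[of "[]" h]] that by (simp add: E_def)
    then show "z \<in> Alg n l \<and> central_op (\<phi> z)"
      using za c[OF xv_Alg] by (simp add: central_op_def)
  next
    assume "z \<in> Alg n l \<and> central_op (\<phi> z)"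
    then show "z \<in> Center n l \<zeta> t" using comm central_op_phi by (simp add: Center_def)
  qed
qed

lemma GenZ_iff: "z \<in> GenZ n l \<zeta> t \<longleftrightarrow> z \<in> Alg n l \<and> \<phi> z \<in> \<phi> ` Subalg"
proof -
  have "sub z y \<in> Ideal n l \<zeta> t \<longleftrightarrow> \<phi> z = \<phi> y" if "z \<in> Alg n l" "y \<in> Subalg" for y
  proof -
    have y: "y \<in> Alg n l" using Subalg_Alg_central[OF that(2)] by simp
    then have "sub z y \<in> Alg n l" using that by blast
    then show ?thesis using that y by (simp add: Ideal_iff phi_sub fin_supp_Alg)
  qed
  then show ?thesis unfolding GenZ_def gens_def[symmetric] by blast
qed

lemma phi_Subalg_add: "S \<in> \<phi> ` Subalg \<Longrightarrow> T \<in> \<phi> ` Subalg \<Longrightarrow> S + T \<in> \<phi> ` Subalg"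
proof (elim imageE)
  fix a b
  assume ab: "S = \<phi> a" "a \<in> Subalg" "T = \<phi> b" "b \<in> Subalg"
  then have "S + T = \<phi> (add a b)"
    using Subalg_Alg_central by (simp add: phi_add fin_supp_Alg)
  then show "S + T \<in> \<phi> ` Subalg" using ab Gen.add by (intro image_eqI)
qed

text \<open>\<open>Gen\<close> contains scalars only as multiples of \<open>one\<close>, so scaling
  is realised as multiplication by \<open>smul c one\<close>.\<close>

lemma phi_Subalg_sc: "T \<in> \<phi> ` Subalg \<Longrightarrow> c \<star> T \<in> \<phi> ` Subalg"
proof -
  assume "T \<in> \<phi> ` Subalg"
  then obtain y where y: "y \<in> Subalg" "T = \<phi> y" by blast
  have "y \<in> Alg n l" using Subalg_Alg_central[OF y(1)] by simp
  then have "\<phi> (smul c one \<odot> y) = c \<star> T"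
    using y(2) by (simp add: phi_mult Alg_smul phi_smul fin_supp_Alg)
  then show ?thesis using Gen.mult[OF Gen.scalar y(1)] by (metis image_eqI)
qed

lemma phi_Subalg_sum: "finite I \<Longrightarrow> (\<And>i. i \<in> I \<Longrightarrow> f i \<in> \<phi> ` Subalg) \<Longrightarrow> sum f I \<in> \<phi> ` Subalg"
proof (induction I rule: finite_induct)
  case empty
  have "\<phi> (smul 0 one) = 0" by (simp add: phi_smul fin_supp_Alg)
  then show ?case using Gen.scalar by (metis image_eqI sum.empty)
qed (simp add: phi_Subalg_add)

text \<open>The first condition bounds the degree of y itself and not only of its class in H;
  \<open>Q_mult\<close> relies on this in \<open>lead_mult\<close>.\<close>

definition lead :: "elt \<Rightarrow> nat multiset \<Rightarrow> bool" where
  "lead y M \<longleftrightarrow> y \<in> Algd (Suc (size M)) \<and> set_mset M \<subseteq> {1..n} \<and> sub y (nf M gunit) \<in> Q (size M)"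

lemma lead_basis: "set w \<subseteq> {1..n} \<Longrightarrow> lead (basis w gunit) (mset w)"
  using perm_Q[of gunit w "sorted_list_of_multiset (mset w)" "[]"]
  by (simp add: lead_def Algd_basis nf_def)

lemma nf_Algd: "set_mset M \<subseteq> {1..n} \<Longrightarrow> nf M gunit \<in> Algd (Suc (size M))"
  unfolding nf_def by (intro Algd_basis) (auto simp flip: size_mset)

lemma lead_mult:
  assumes "lead a M" "lead b N"
  shows "lead (a \<odot> b) (M + N)"
proof -
  have a: "a \<in> Algd (Suc (size M))" "sub a (nf M gunit) \<in> Q (size M)" "set_mset M \<subseteq> {1..n}"
    and b: "b \<in> Algd (Suc (size N))" "sub b (nf N gunit) \<in> Q (size N)" "set_mset N \<subseteq> {1..n}"
    using assms by (auto simp: lead_def)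
  let ?m = "nf M gunit" and ?k = "nf N gunit"
  have mk: "?m \<in> Algd (Suc (size M))" "?k \<in> Algd (Suc (size N))" using a b by (simp_all add: nf_Algd)
  have fin: "finite (supp a)" "finite (supp b)" "finite (supp ?m)" "finite (supp ?k)"
    using a b mk by (simp_all add: fin_supp_Alg Algd_Alg)
  have "?m \<odot> ?k = basis (sorted_list_of_multiset M @ sorted_list_of_multiset N) gunit"
    by (simp add: nf_def mult_basis)
  then have "sub (?m \<odot> ?k) (nf (M + N) gunit) \<in> Q (size (M + N))"
    using lead_basis[of "sorted_list_of_multiset M @ sorted_list_of_multiset N"] a(3) b(3)
    by (simp add: lead_def)
  moreover have "sub a ?m \<odot> b \<in> Q (size (M + N))"
    using Q_mult(1)[OF a(2) b(1)] by simp
  moreover have "?m \<odot> sub b ?k \<in> Q (size (M + N))"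
    using Q_mult(2)[OF b(2) mk(1)] by (simp add: add.commute)
  \<comment> \<open>With m and k the sorted leading monomials of a and b, this is a b - m k = (a -
    m) b + m (b - k), followed by sorting m k.\<close>
  ultimately have "add (sub (?m \<odot> ?k) (nf (M + N) gunit)) (add (sub a ?m \<odot> b) (?m \<odot> sub b ?k)) \<in> Q (size (M + N))"
    by (intro Q_add)
  moreover have "sub (a \<odot> b) (nf (M + N) gunit)
      = add (sub (?m \<odot> ?k) (nf (M + N) gunit)) (add (sub a ?m \<odot> b) (?m \<odot> sub b ?k))"
    using fin by (simp add: mult_sub_left mult_sub_right) (simp add: add_def sub_def)
  moreover have "a \<odot> b \<in> Algd (Suc (size (M + N)))" using Algd_mult[OF a(1) b(1)] by simp
  ultimately show ?thesis using a(3) b(3) by (simp add: lead_def)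
qed

lemma lead_wel: "lead (wel n l \<zeta> t) (mset [1..<n+1])"
proof -
  have b: "lead (basis [1..<n+1] gunit) (mset [1..<n+1])" by (intro lead_basis) auto
  have len: "size (mset [1..<n+1]) = n" by simp
  let ?r = "sub (wel n l \<zeta> t) (basis [1..<n+1] gunit)"
  have w: "wel n l \<zeta> t = add (basis [1..<n+1] gunit) ?r" by (simp add: add_def sub_def)
  have "?r \<in> Algd (Suc n)" using wel_lead Algd_mono by (meson le_SucI order_refl)
  then have 1: "wel n l \<zeta> t \<in> Algd (Suc n)"
    using b unfolding lead_def len by (subst w) (blast intro: Algd_add)
  have "sub (wel n l \<zeta> t) (nf (mset [1..<n+1]) gunit) \<in> Q n"
    using b Q_Algd[OF wel_lead] unfolding lead_def len by (blast intro: Q_sub_trans)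
  with 1 b show ?thesis unfolding lead_def len by blast
qed

text \<open>If some exponent reaches l, a factor x_j^l is split off. Otherwise all exponents are
  below l and congruent, hence equal, and x^M is a power of x_1...x_n, from which the leading
  monomial of w is split off.\<close>

lemma lead_exists:
  "set_mset M \<subseteq> {1..n} \<Longrightarrow> \<forall>j\<in>{1..n}. [count M j = count M 1] (mod l) \<Longrightarrow> \<exists>y\<in>Subalg. lead y M"
proof (induction "size M" arbitrary: M rule: less_induct)
  case less
  show ?case
  proof (cases "\<exists>j\<in>{1..n}. l \<le> count M j")
    case True
    then obtain j where j: "j \<in> {1..n}" "l \<le> count M j" by blast
    define N where "N = M - replicate_mset l j"
    have M: "M = replicate_mset l j + N"
      using j(2) by (simp add: N_def count_le_replicate_mset_subset_eq)
    have "set_mset N \<subseteq> {1..n}" using less.prems(1) M by auto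
    moreover have "[count N i = count M i] (mod l)" for i
      unfolding M by (simp add: cong_def)
    then have "\<forall>i\<in>{1..n}. [count N i = count N 1] (mod l)"
      using less.prems(2) by (meson cong_sym cong_trans)
    moreover have "size N < size M" using l2 by (simp add: M)
    ultimately obtain y where y: "y \<in> Subalg" "lead y N" using less.hyps by blast
    have "mpow n l \<zeta> (xv j) l \<in> Subalg" using j by (intro Gen.gen) (auto simp: gens_def)
    moreover have "lead (mpow n l \<zeta> (xv j) l) (replicate_mset l j)"
      using lead_basis[of "replicate l j"] j(1) by (simp add: mpow_xv set_replicate_conv_if)
    ultimately show ?thesis using y lead_mult Gen.mult unfolding M by blast
  next
    case False
    have 1: "1 \<in> {1..n}" using n3 by simp
    have c: "count M j = count M 1" if "j \<in> {1..n}" for j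
      using less.prems(2) False that 1 by (metis cong_less_modulus_unique_nat not_le)
    show ?thesis
    proof (cases "count M 1 = 0")
      case True
      have "M = {#}"
      proof (rule ccontr)
        assume "M \<noteq> {#}"
        then obtain x where "x \<in># M" by (meson multiset_nonemptyE)
        with less.prems(1) have "x \<in> {1..n}" by blast
        then have "count M x = 0" by (rule trans[OF c True])
        then have "x \<notin># M" unfolding count_eq_zero_iff .
        with \<open>x \<in># M\<close> show False by blast
      qed
      moreover have "lead one {#}" using lead_basis[of "[]"] by (simp add: one_def)
      moreover have "one \<in> Subalg" using Gen.scalar[of 1] by simp
      ultimately show ?thesis by blast
    next
      case False
      define N where "N = M - mset [1..<n+1]"
      have cnt: "count (mset [1..<n+1]) i = (if i \<in> {1..n} then 1 else 0)" for i
        by (subst distinct_count_atmost_1[THEN iffD1, rule_format, of "[1..<n+1]"]) auto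
      have "(if i \<in> {1..n} then 1 else 0) \<le> count M i" for i
        using c[of i] False by auto
      then have "mset [1..<n+1] \<subseteq># M"
        unfolding subseteq_mset_def cnt by blast
      then have M: "M = mset [1..<n+1] + N" by (simp add: N_def)
      have N: "set_mset N \<subseteq> {1..n}" using less.prems(1) M by auto
      have "count N i = count M i - 1" if "i \<in> {1..n}" for i
        using that by (simp only: N_def count_diff cnt if_True)
      then have "count N i = count N 1" if "i \<in> {1..n}" for i
        using c[OF that] that 1 by presburger
      then have "\<forall>i\<in>{1..n}. [count N i = count N 1] (mod l)" using cong_refl by metis
      moreover have "size N < size M" using n3 by (simp add: M del: upt_Suc)
      ultimately obtain y where y: "y \<in> Subalg" "lead y N" using less.hyps N by blast
      have "wel n l \<zeta> t \<in> Subalg" by (intro Gen.gen) (simp add: gens_def)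
      then show ?thesis using y lead_mult[OF lead_wel] Gen.mult unfolding M by blast
    qed
  qed
qed

section \<open>Leading coefficients of commutators\<close>

lemma mult_basis_right_at:
  assumes "z \<in> Alg n l"
  shows "(z \<odot> basis v h) x = (\<Sum>p\<in>supp z. if pm p (v, h) = x then z p * co p (v, h) else 0)"
proof -
  have "(z \<odot> basis v h) x = (\<Sum>(p, q)\<in>supp z \<times> {(v, h)}. if pm p q = x then z p * basis v h q * co p q else 0)"
    using fin_supp_Alg[OF assms] by (intro mult_expand) auto
  also have "\<dots> = (\<Sum>p\<in>supp z. \<Sum>q\<in>{(v, h)}. if pm p q = x then z p * basis v h q * co p q else 0)"
    by (simp only: sum.cartesian_product)
  also have "\<dots> = (\<Sum>p\<in>supp z. if pm p (v, h) = x then z p * co p (v, h) else 0)"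
    by (intro sum.cong refl) (simp add: basis_def)
  finally show ?thesis .
qed

lemma mult_basis_left_at:
  assumes "z \<in> Alg n l"
  shows "(basis v h \<odot> z) x = (\<Sum>p\<in>supp z. if pm (v, h) p = x then z p * co (v, h) p else 0)"
proof -
  have "(basis v h \<odot> z) x = (\<Sum>(q, p)\<in>{(v, h)} \<times> supp z. if pm q p = x then basis v h q * z p * co q p else 0)"
    using fin_supp_Alg[OF assms] by (intro mult_expand) auto
  also have "\<dots> = (\<Sum>q\<in>{(v, h)}. \<Sum>p\<in>supp z. if pm q p = x then basis v h q * z p * co q p else 0)"
    by (simp only: sum.cartesian_product)
  also have "\<dots> = (\<Sum>p\<in>supp z. if pm (v, h) p = x then z p * co (v, h) p else 0)"
    by (simp add: basis_def cong: if_cong)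
  finally show ?thesis .
qed

lemma sum_supp_single:
  assumes "z \<in> Alg n l" and "\<And>p. p \<in> supp z \<Longrightarrow> Pr p \<longleftrightarrow> p = y"
  shows "(\<Sum>p\<in>supp z. if Pr p then z p * f p else 0) = z y * f y"
proof -
  have "(\<Sum>p\<in>supp z. if Pr p then z p * f p else 0) = (\<Sum>p\<in>supp z. if p = y then z p * f p else 0)"
    using assms(2) by (intro sum.cong) auto
  also have "\<dots> = z y * f y" using fin_supp_Alg[OF assms(1)] by (auto simp: sum.delta supp_def)
  finally show ?thesis .
qed

text \<open>The computation takes place in the twisted tensor algebra: the words of z x_j are those
  of z with j appended, and g picks up the character of x_j.\<close>

lemma symb_mult_xv_right:
  assumes z: "z \<in> Alg n l" and g: "g \<in> Gset n l"
  shows "symb (z \<odot> xv j) (add_mset j M) g = \<zeta> ^ g j * symb z M g"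
proof -
  have s: "gm (snd p) gunit = snd p" if "p \<in> supp z" for p
    using suppD[OF z, of "fst p" "snd p"] that by simp
  have 1: "(z \<odot> xv j) (w @ [j], g) = z (w, g) * \<zeta> ^ g j" for w
    unfolding xv_def mult_basis_right_at[OF z]
    by (subst sum_supp_single[OF z, of _ "(w, g)"]) (auto simp: s chi_Cons)
  have 2: "(z \<odot> xv j) (u, g) = 0" if "\<And>w. u \<noteq> w @ [j]" for u
    unfolding xv_def mult_basis_right_at[OF z] using that by (intro sum.neutral) auto
  have "symb (z \<odot> xv j) (add_mset j M) g = (\<Sum>u\<in>(\<lambda>w. w @ [j]) ` {w. mset w = M}. (z \<odot> xv j) (u, g))"
    unfolding symb_def
  proof (rule sum.mono_neutral_right[OF finite_mset_eq])
    show "\<forall>u\<in>{w. mset w = add_mset j M} - (\<lambda>w. w @ [j]) ` {w. mset w = M}. (z \<odot> xv j) (u, g) = 0"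
    proof
      fix u assume "u \<in> {w. mset w = add_mset j M} - (\<lambda>w. w @ [j]) ` {w. mset w = M}"
      then show "(z \<odot> xv j) (u, g) = 0" by (intro 2) auto
    qed
  qed auto
  also have "\<dots> = \<zeta> ^ g j * symb z M g"
    unfolding symb_def sum_distrib_left by (subst sum.reindex) (auto simp: inj_on_def 1 mult.commute)
  finally show ?thesis .
qed

lemma symb_mult_xv_left:
  assumes z: "z \<in> Alg n l" and g: "g \<in> Gset n l"
  shows "symb (xv j \<odot> z) (add_mset j M) g = symb z M g"
proof -
  have s: "gm gunit (snd p) = snd p" if "p \<in> supp z" for p
    using suppD[OF z, of "fst p" "snd p"] that by simp
  have 1: "(xv j \<odot> z) (j # w, g) = z (w, g)" for w
    unfolding xv_def mult_basis_left_at[OF z]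
    by (subst sum_supp_single[OF z, of _ "(w, g)"]) (auto simp: s)
  have 2: "(xv j \<odot> z) (u, g) = 0" if "\<And>w. u \<noteq> j # w" for u
    unfolding xv_def mult_basis_left_at[OF z] using that by (intro sum.neutral) auto
  have "symb (xv j \<odot> z) (add_mset j M) g = (\<Sum>u\<in>(\<lambda>w. j # w) ` {w. mset w = M}. (xv j \<odot> z) (u, g))"
    unfolding symb_def
  proof (rule sum.mono_neutral_right[OF finite_mset_eq])
    show "\<forall>u\<in>{w. mset w = add_mset j M} - (\<lambda>w. j # w) ` {w. mset w = M}. (xv j \<odot> z) (u, g) = 0"
    proof
      fix u assume "u \<in> {w. mset w = add_mset j M} - (\<lambda>w. j # w) ` {w. mset w = M}"
      then show "(xv j \<odot> z) (u, g) = 0" by (intro 2) auto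
    qed
  qed auto
  also have "\<dots> = symb z M g"
    unfolding symb_def by (subst sum.reindex) (auto simp: inj_on_def 1)
  finally show ?thesis .
qed

lemma gm_cancel: "g \<in> Gset n l \<Longrightarrow> h \<in> Gset n l \<Longrightarrow> gm g h = h \<longleftrightarrow> g = gunit"
proof
  assume g: "g \<in> Gset n l" and h: "h \<in> Gset n l" and e: "gm g h = h"
  have "g j = 0" for j
  proof (cases "j \<in> {1..n}")
    case True
    have lt: "g j < l" "h j < l" using g h by (auto simp: Gset_def)
    have "(g j + h j) mod l = h j mod l" using fun_cong[OF e, of j] True lt by (simp add: gmul_def)
    then have "[g j + h j = 0 + h j] (mod l)" by (simp add: cong_def)
    then have "[g j = 0] (mod l)" by (simp only: cong_add_rcancel_nat)
    then show ?thesis using lt by (simp add: cong_def)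
  qed (use g in \<open>auto simp: Gset_def\<close>)
  then show "g = gunit" by (auto simp: gunit_def)
qed simp

lemma sum_list_ge: "k \<in> {1..n} \<Longrightarrow> sum_list (map (ge k) w) = count (mset w) k + (l - 1) * count (mset w) (nx k)"
  using nx_neq[of k] by (induction w) (auto simp: gen_def)

text \<open>At the group element h only the \<open>gunit\<close> part of z contributes, and there
  the cocycle is trivial; the commutator with h thus isolates the action of h on words.\<close>

lemma symb_mult_ge_right:
  assumes z: "z \<in> Alg n l" and h: "h \<in> Gset n l"
  shows "symb (z \<odot> basis [] h) M h = symb z M gunit"
proof -
  have s: "gm (snd p) h = h \<longleftrightarrow> snd p = gunit" if "p \<in> supp z" for p
    using suppD[OF z, of "fst p" "snd p"] that gm_cancel[OF _ h] by simp
  have "(z \<odot> basis [] h) (w, h) = z (w, gunit)" for w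
    unfolding mult_basis_right_at[OF z]
    by (subst sum_supp_single[OF z, of _ "(w, gunit)"]) (auto simp: s)
  then show ?thesis by (simp add: symb_def)
qed

lemma symb_mult_ge_left:
  assumes z: "z \<in> Alg n l" and k: "k \<in> {1..n}"
  shows "symb (basis [] (ge k) \<odot> z) M (ge k) = \<zeta> ^ (count M k + (l - 1) * count M (nx k)) * symb z M gunit"
proof -
  have s: "gm (ge k) (snd p) = ge k \<longleftrightarrow> snd p = gunit" if "p \<in> supp z" for p
    using suppD[OF z, of "fst p" "snd p"] that gm_cancel[OF _ Gset_ge[OF k]] by (simp add: gm_comm)
  have 1: "(basis [] (ge k) \<odot> z) (w, ge k) = z (w, gunit) * chi \<zeta> (ge k) w" for w
    unfolding mult_basis_left_at[OF z]
    by (subst sum_supp_single[OF z, of _ "(w, gunit)"]) (auto simp: s)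
  show ?thesis unfolding symb_def sum_distrib_left
    by (intro sum.cong refl) (auto simp: 1 chi_def sum_list_ge[OF k])
qed

lemma symb_sub: "symb (sub f g) M h = symb f M h - symb g M h"
  by (simp add: symb_def sub_def sum_subtractf)

text \<open>In degree d + 1 the commutator with x_j has the coefficient (zeta^(g_j) - 1) symb z M g,
  which forces g = 1. Then in degree d the commutator with g_k has the coefficient symb z M 1 times
  1 - zeta^(M_k - M_(k+1)), which forces M_k and M_(k+1) to be congruent modulo l.\<close>

lemma central_top:
  assumes z: "z \<in> Algd (Suc d)" and c: "central_op (\<phi> z)"
    and M: "size M = d" "set_mset M \<subseteq> {1..n}" and g: "g \<in> Gset n l" and nz: "symb z M g \<noteq> 0"
  shows "g = gunit" "\<forall>j\<in>{1..n}. [count M j = count M 1] (mod l)"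
proof -
  have za: "z \<in> Alg n l" using z by (rule Algd_Alg)
  have "g j = 0" for j
  proof (cases "j \<in> {1..n}")
    case True
    let ?r = "sub (z \<odot> xv j) (xv j \<odot> z)"
    have x: "xv j \<in> Algd 2" unfolding xv_def using True by (intro Algd_basis) auto
    have "?r \<in> Algd (Suc (Suc d))" using Algd_mult[OF z x] Algd_mult[OF x z] by (simp add: Algd_sub)
    moreover have "\<phi> ?r = 0"
      using c True za by (simp add: phi_sub phi_mult fin_supp_Alg central_op_def)
    ultimately have "symb ?r (add_mset j M) g = 0"
      using symb_app[of ?r "Suc d" "add_mset j M" g] M g True by simp
    then have "\<zeta> ^ g j = 1"
      using nz by (simp add: symb_sub symb_mult_xv_left[OF za g] symb_mult_xv_right[OF za g])
    moreover have "g j < l" using g by (simp add: Gset_def)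
    ultimately show ?thesis using prim[of "g j"] by blast
  qed (use g in \<open>auto simp: Gset_def\<close>)
  then show gu: "g = gunit" by (auto simp: gunit_def)
  have step: "[count M k = count M (nx k)] (mod l)" if k: "k \<in> {1..n}" for k
  proof -
    let ?h = "basis [] (ge k)"
    let ?r = "sub (z \<odot> ?h) (?h \<odot> z)"
    have x: "?h \<in> Algd 1" using k by (intro Algd_basis) auto
    have "?r \<in> Algd (Suc d)" using Algd_mult[OF z x] Algd_mult[OF x z] by (simp add: Algd_sub)
    moreover have "\<phi> ?r = 0"
      using c k za Algd_Alg[OF x] by (simp add: phi_sub phi_mult fin_supp_Alg central_op_def E_def)
    ultimately have "symb ?r M (ge k) = 0"
      using symb_app[of ?r d M "ge k"] M k by simp
    then have "\<zeta> ^ (count M k + (l - 1) * count M (nx k)) = 1"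
      using nz k unfolding gu by (simp add: symb_sub symb_mult_ge_left[OF za k] symb_mult_ge_right[OF za])
    then have "[count M k + (l - 1) * count M (nx k) = 0] (mod l)"
      by (simp only: zpow_eq_1 cong_0_iff)
    \<comment> \<open>Adding \<open>count M (nx k)\<close> turns the factor l - 1, which stands for
      -1, into l.\<close>
    then have c0: "[count M k + (l - 1) * count M (nx k) + count M (nx k) = 0 + count M (nx k)] (mod l)"
      by (rule cong_add) (rule cong_refl)
    have e: "count M k + (l - 1) * count M (nx k) + count M (nx k) = count M k + l * count M (nx k)"
      using l2 by (cases l) auto
    show ?thesis using c0 unfolding e cong_def by simp
  qed
  have "j \<in> {1..n} \<Longrightarrow> [count M j = count M 1] (mod l)" for j
  proof (induction j)
    case (Suc j)
    show ?case
    proof (cases "j = 0")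
      case False
      then have "[count M j = count M (Suc j)] (mod l)" "[count M j = count M 1] (mod l)"
        using step[of j] Suc by (auto simp: nxt_def)
      then show ?thesis by (meson cong_sym cong_trans)
    qed simp
  qed simp
  then show "\<forall>j\<in>{1..n}. [count M j = count M 1] (mod l)" by blast
qed

text \<open>The statement concerns \<open>\<phi> z\<close> because the remainder of lower degree is
  determined only modulo the ideal. The remainder is again central, since the subtracted combination
  lies in the image of \<open>Subalg\<close>.\<close>

lemma central_in_Subalg: "z \<in> Algd d \<Longrightarrow> central_op (\<phi> z) \<Longrightarrow> \<phi> z \<in> \<phi> ` Subalg"
proof (induction d arbitrary: z)
  case 0
  then have "z = (\<lambda>_. 0)" by (auto simp: Algd_def Sp_def supp_def)
  then show ?case using phi_Subalg_sum[of "{}"] by simp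
next
  case (Suc d)
  have za: "z \<in> Alg n l" using Suc.prems(1) by (rule Algd_Alg)
  \<comment> \<open>Pairs with vanishing coefficient are dropped, as \<open>central_top\<close> says
    nothing about them.\<close>
  define T where "T = {q \<in> topset d z. symb z (fst q) (snd q) \<noteq> 0}"
  have finT: "finite T" using topset_finite[OF za] by (simp add: T_def)
  have ex: "\<exists>y\<in>Subalg. sub y (nf (fst q) (snd q)) \<in> Q d" if q: "q \<in> T" for q
  proof -
    obtain M g where Mg: "q = (M, g)" "(M, g) \<in> topset d z" "symb z M g \<noteq> 0"
      using q by (cases q) (simp add: T_def)
    have *: "size M = d" "set_mset M \<subseteq> {1..n}" "g \<in> Gset n l" using topset_D[OF za Mg(2)] by auto
    note ct = central_top[OF Suc.prems *(1) *(2) *(3) Mg(3)]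
    show ?thesis using lead_exists[OF *(2) ct(2)] *(1) by (auto simp: lead_def Mg ct(1))
  qed
  then have "\<forall>q\<in>T. \<exists>y. y \<in> Subalg \<and> sub y (nf (fst q) (snd q)) \<in> Q d" by blast
  then obtain y where "\<forall>q\<in>T. y q \<in> Subalg \<and> sub (y q) (nf (fst q) (snd q)) \<in> Q d"
    by (rule bchoice[THEN exE])
  then have y: "\<And>q. q \<in> T \<Longrightarrow> y q \<in> Subalg" "\<And>q. q \<in> T \<Longrightarrow> sub (y q) (nf (fst q) (snd q)) \<in> Q d"
    by simp_all
  have yA: "y q \<in> Alg n l" if "q \<in> T" for q using Subalg_Alg_central[OF y(1)[OF that]] by simp
  let ?c = "\<lambda>q. symb z (fst q) (snd q)"
  let ?S = "\<lambda>x. \<Sum>q\<in>T. smul (?c q) (y q) x"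
  have "(\<lambda>x. \<Sum>q\<in>T. smul (?c q) (sub (y q) (nf (fst q) (snd q))) x) \<in> Q d"
    using y(2) by (intro Q_sum finT Q_smul)
  from Q_sub[OF reduce_Q[OF Suc.prems(1)] this]
  have "sub (sub z (\<lambda>x. \<Sum>(M, g)\<in>topset d z. symb z M g * nf M g x))
    (\<lambda>x. \<Sum>q\<in>T. smul (?c q) (sub (y q) (nf (fst q) (snd q))) x) \<in> Q d" .
  moreover have "(\<Sum>(M, g)\<in>topset d z. symb z M g * nf M g x) = (\<Sum>q\<in>T. ?c q * nf (fst q) (snd q) x)" for x
    using topset_finite[OF za] by (intro sum.mono_neutral_cong_right) (auto simp: T_def)
  ultimately have "sub z ?S \<in> Q d"
    by (simp add: sub_def smul_def right_diff_distrib sum_subtractf)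
  then obtain i r where ir: "i \<in> Ideal n l \<zeta> t" "r \<in> Algd d" "sub z ?S = add i r" by (auto simp: Q_def)
  have phiS: "\<phi> ?S = (\<Sum>q\<in>T. ?c q \<star> \<phi> (y q))"
    using yA by (subst phi_sum[OF finT]) (auto simp: phi_smul fin_supp_Alg intro!: sum.cong)
  have SA: "?S \<in> Alg n l" using yA by (intro Alg_sum finT Alg_smul)
  have "\<phi> z - \<phi> ?S = \<phi> (sub z ?S)"
    by (rule phi_sub[symmetric]) (rule fin_supp_Alg, fact)+
  also have "\<dots> = \<phi> i + \<phi> r"
    unfolding ir(3) using ir by (intro phi_add fin_supp_Alg Ideal_Alg Algd_Alg)
  finally have r: "\<phi> r = \<phi> z - \<phi> ?S" using phi_Ideal[OF ir(1)] by (simp only: add_0)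
  have "central_op (\<phi> ?S)" unfolding phiS
    using Subalg_Alg_central[OF y(1)] by (intro central_op_sum central_op_sc) simp
  then have "central_op (\<phi> r)" unfolding r using Suc.prems(2) by (intro central_op_diff)
  then have "\<phi> r \<in> \<phi> ` Subalg" using Suc.IH[OF ir(2)] by simp
  moreover have "\<phi> ?S \<in> \<phi> ` Subalg" unfolding phiS
    using y(1) by (intro phi_Subalg_sum finT phi_Subalg_sc) simp
  ultimately have "\<phi> r + \<phi> ?S \<in> \<phi> ` Subalg" by (rule phi_Subalg_add)
  then show ?case by (simp add: r)
qed

lemma Center_eq_GenZ: "Center n l \<zeta> t = GenZ n l \<zeta> t"
proof -
  have "central_op (\<phi> z) \<longleftrightarrow> \<phi> z \<in> \<phi> ` Subalg" if "z \<in> Alg n l" for z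
    using that Alg_Algd central_in_Subalg Subalg_Alg_central by (metis imageE)
  then show ?thesis by (auto simp: set_eq_iff Center_iff GenZ_iff)
qed

end

theorem theorem1p2:
  fixes n l :: nat and \<zeta> :: complex and t :: "nat \<Rightarrow> complex"
  assumes "n \<ge> 3" and "l \<ge> 2"
    and "\<zeta> ^ l = 1" and "\<forall>k. 0 < k \<and> k < l \<longrightarrow> \<zeta> ^ k \<noteq> 1"
  shows "Center n l \<zeta> t = GenZ n l \<zeta> t"
proof -
  interpret twisted_hecke n l \<zeta> t
    using assms by unfold_locales auto
  show ?thesis by (rule Center_eq_GenZ)
qed

end
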